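(* Let $T$ be a tournament on 8 vertices with score sequence $S$. Suppose that at least one of the following holds: $S$ contains $0$; $S$ contains $7$; $S$ contains the subsequence $1,1$; $S$ contains the subsequence $6,6$; $S$ contains the subsequence $1,\ldots,5,5,6$ (that is, $S$ has an entry $1$, two entries $5$ and an entry $6$); $S$ contains the subsequence $1,2,2,\ldots,6$ (that is, $S$ has an entry $1$, two entries $2$ and an entry $6$). Then $T$ is not intrinsically linked as a directed graph.
   Context: A tournament is a directed graph with exactly one directed edge between each pair of distinct vertices. Its score sequence is the list of outdegrees of its vertices in non-decreasing order. A cycle in a directed graph is consistently oriented if it is a directed cycle. A directed graph $G$ is intrinsically linked as a directed graph if every (tame) embedding of $G$ into $S^3$ contains two vertex-disjoint consistently oriented cycles that form a non-split link. *)

theory Defs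
  imports
    "HOL-Analysis.Analysis"
    "HOL-Library.Sublist"
    "HOL-Library.Multiset"
    "Graph_Theory.Arc_Walk"
begin

definition tournament :: "('a, 'b) pre_digraph \<Rightarrow> bool" where
  "tournament G \<longleftrightarrow> digraph G \<and>
     (\<forall>u \<in> verts G. \<forall>v \<in> verts G. u \<noteq> v \<longrightarrow>
        (\<exists>!e. e \<in> arcs G \<and> {tail G e, head G e} = {u, v}))"

definition score_sequence :: "('a, 'b) pre_digraph \<Rightarrow> nat list" where
  "score_sequence G = sorted_list_of_multiset (image_mset (out_degree G) (mset_set (verts G)))"

abbreviation S3 :: "(real ^ 4) set" where
  "S3 \<equiv> sphere 0 1"

(* Polyhedra for the standard PL structure of S3: the radial projection of a convex polytope P
   that misses the origin is a spherical convex polytope (for a segment P, a great-circle arc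
   shorter than a half circle). *)
definition spherical_polyhedron :: "(real ^ 4) set \<Rightarrow> bool" where
  "spherical_polyhedron X \<longleftrightarrow>
     (\<exists>\<P>. finite \<P> \<and> (\<forall>P \<in> \<P>. polytope P \<and> 0 \<notin> P) \<and>
        X = (\<Union>P \<in> \<P>. (\<lambda>x. x /\<^sub>R norm x) ` P))"

(* A subset of S3 is tame if a self-homeomorphism of S3 carries it onto a polyhedron. *)
definition tame :: "(real ^ 4) set \<Rightarrow> bool" where
  "tame X \<longleftrightarrow> X \<subseteq> S3 \<and>
     (\<exists>h k. homeomorphism S3 S3 h k \<and> spherical_polyhedron (h ` X))"

definition embedding_image ::
  "('a, 'b) pre_digraph \<Rightarrow> ('a \<Rightarrow> real ^ 4) \<Rightarrow> ('b \<Rightarrow> real \<Rightarrow> real ^ 4) \<Rightarrow> (real ^ 4) set" where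
  "embedding_image G p g = p ` verts G \<union> (\<Union>e \<in> arcs G. path_image (g e))"

(* A topological embedding in S3 of the graph G, regarded as a 1-dimensional cell complex, given
   by its values p on the vertices and g on the edges, each edge being parametrised by {0..1}
   from its tail to its head. As p is injective on the vertices, simple_path makes g e injective
   if e is not a loop, and a simple closed curve if it is one. *)
definition graph_embedding ::
  "('a, 'b) pre_digraph \<Rightarrow> ('a \<Rightarrow> real ^ 4) \<Rightarrow> ('b \<Rightarrow> real \<Rightarrow> real ^ 4) \<Rightarrow> bool" where
  "graph_embedding G p g \<longleftrightarrow>
     embedding_image G p g \<subseteq> S3 \<and>
     inj_on p (verts G) \<and>
     (\<forall>e \<in> arcs G. simple_path (g e) \<and>
        pathstart (g e) = p (tail G e) \<and> pathfinish (g e) = p (head G e) \<and>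
        g e ` {0<..<1} \<inter> p ` verts G = {}) \<and>
     (\<forall>e \<in> arcs G. \<forall>e' \<in> arcs G. e \<noteq> e' \<longrightarrow> g e ` {0<..<1} \<inter> g e' ` {0<..<1} = {})"

(* The link with components K and L is split if a (tame) 2-sphere separates K from L. *)
definition split_link :: "(real ^ 4) set \<Rightarrow> (real ^ 4) set \<Rightarrow> bool" where
  "split_link K L \<longleftrightarrow>
     (\<exists>S. tame S \<and> S homeomorphic sphere (0 :: real ^ 3) 1 \<and>
        (\<exists>C \<in> components (S3 - S). \<exists>D \<in> components (S3 - S).
           C \<noteq> D \<and> K \<subseteq> C \<and> L \<subseteq> D))"

(* Cycles are lists of arcs; every vertex of a cycle is the tail of exactly one of its arcs. *)
definition cycle_verts :: "('a, 'b) pre_digraph \<Rightarrow> 'b list \<Rightarrow> 'a set" where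
  "cycle_verts G c = tail G ` set c"

definition cycle_image :: "('b \<Rightarrow> real \<Rightarrow> real ^ 4) \<Rightarrow> 'b list \<Rightarrow> (real ^ 4) set" where
  "cycle_image g c = (\<Union>e \<in> set c. path_image (g e))"

(* pre_digraph.cycle only admits walks that follow the orientation of the arcs, so it describes
   precisely the consistently oriented cycles. *)
definition intrinsically_linked_digraph :: "('a, 'b) pre_digraph \<Rightarrow> bool" where
  "intrinsically_linked_digraph G \<longleftrightarrow>
     (\<forall>p g. graph_embedding G p g \<and> tame (embedding_image G p g) \<longrightarrow>
        (\<exists>c d. pre_digraph.cycle G c \<and> pre_digraph.cycle G d \<and>
           cycle_verts G c \<inter> cycle_verts G d = {} \<and>
           \<not> split_link (cycle_image g c) (cycle_image g d)))"

end

theory Submission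
  imports Defs
begin

text \<open>
  Place the eight vertices on the moment curve \<open>t \<mapsto> (1, t, t\<^sup>2, t\<^sup>3)\<close> at \<open>t = 0, ..., 7\<close>, join them by
  straight segments and project radially to the 3-sphere. Only the order of the vertices along the
  curve is left to choose, and it can be chosen so that no two disjoint directed cycles form a
  non-split link.

  \<^bold>\<open>Geometry.\<close> On the moment curve a linear functional is a cubic polynomial, so it can change sign at
  three prescribed places. Hence an arc can be separated by a hyperplane through the origin from a set
  \<open>A\<close> of vertices unless \<open>A\<close> has vertices before, between and after the two ends of the arc
  (\<open>cubic_separation\<close>). If all arcs of a cycle can be separated from the vertices \<open>A\<close> of another one, the
  separating hyperplanes bound a convex cone that contains the second cycle in its interior and the first one
  in its exterior, and the trace of the boundary of the cone on the 3-sphere is a polyhedral 2-sphere that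
  splits the link (\<open>split_by_cone\<close>). So if two disjoint cycles do not split, each of them has an arc that
  pierces the other one, and then their vertices alternate at least six times along the curve
  (\<open>alternate_if_mutually_piercing\<close>).

  \<^bold>\<open>Combinatorics.\<close> It remains to order the vertices so that no two disjoint directed cycles alternate six times.
  All that is used of a cycle is that each of its vertices has a successor and a predecessor on it. A
  vertex of out-degree one therefore drags its out-neighbour into every cycle through it; if it is placed next
  to this neighbour, both count as one vertex for the alternation. This reduces the number of vertices that
  matter:

  \<^item> If there are two vertices of out-degree one, or a vertex of out-degree one and a vertex of in-degree one
    that do not lie on a common arc, then six blocks remain. Six alternating blocks leave only one partition into
    two triples, and one of these triples can be made transitive.

  \<^item> If the vertex of out-degree one sends its arc to the vertex of in-degree one, seven blocks remain. Two
    vertices of out-degree five then have in-degree two, and one of their in-neighbours is known; this gives a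
    path of three vertices that two disjoint cycles can only share in a very restricted way.

  \<^item> A vertex of out-degree zero lies on no cycle, and every tournament on the other seven vertices has a good
    order: it contains one of two patterns of seven arcs (\<open>has_untangled_order_of_7\<close>).

  The other hypotheses follow by reversing all arcs, which does not change the cycles as sets.
\<close>

section \<open>Splitting by the boundary of a polyhedral cone\<close>

text \<open>
  If the cone of all \<open>x\<close> with \<open>n \<bullet> x \<ge> 0\<close> for \<open>n \<in> N\<close> has interior points, this is the trace of its boundary on
  the 3-sphere.
\<close>

definition cone_sphere :: "(real^4) set \<Rightarrow> (real^4) set" where
  "cone_sphere N = {x \<in> S3. (\<forall>n\<in>N. 0 \<le> n \<bullet> x) \<and> (\<exists>n\<in>N. n \<bullet> x = 0)}"

lemma sgn_scaleR_pos: "0 < k \<Longrightarrow> sgn (k *\<^sub>R x) = sgn (x::'a::real_normed_vector)"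
  by (simp add: sgn_scaleR)

lemma sgn_eqD:
  fixes x y :: "'a::real_normed_vector"
  assumes "sgn x = sgn y" "x \<noteq> 0" "y \<noteq> 0"
  obtains k where "0 < k" "x = k *\<^sub>R y"
proof
  show "0 < norm x / norm y" using assms by simp
  have "x = norm x *\<^sub>R sgn x" using assms(2) by (simp add: sgn_div_norm)
  also have "\<dots> = (norm x / norm y) *\<^sub>R y" unfolding assms(1) by (simp add: sgn_div_norm divide_inverse)
  finally show "x = (norm x / norm y) *\<^sub>R y" .
qed

lemma continuous_on_sgn_nonzero:
  fixes S :: "'a::real_normed_vector set"
  assumes "0 \<notin> S" shows "continuous_on S sgn"
  unfolding sgn_div_norm using assms by (intro continuous_intros) auto

lemma connected_sgn_image:
  fixes S :: "'a::real_normed_vector set"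
  assumes "convex S" "0 \<notin> S" shows "connected (sgn ` S)"
  by (intro connected_continuous_image continuous_on_sgn_nonzero convex_connected assms)

lemma spherical_polyhedronI:
  assumes "finite \<P>" "\<And>P. P \<in> \<P> \<Longrightarrow> polytope P" "\<And>P. P \<in> \<P> \<Longrightarrow> 0 \<notin> P"
    and "X = (\<Union>P\<in>\<P>. sgn ` P)"
  shows "spherical_polyhedron X"
  unfolding spherical_polyhedron_def
proof (intro exI conjI ballI)
  show "X = (\<Union>P\<in>\<P>. (\<lambda>x. x /\<^sub>R norm x) ` P)" using assms(4) by (simp add: sgn_div_norm)
qed (use assms(1-3) in auto)

lemma tame_spherical_polyhedron:
  assumes "X \<subseteq> S3" "spherical_polyhedron X" shows "tame X"
  unfolding tame_def
proof (intro conjI exI)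
  show "homeomorphism S3 S3 id id" by (simp add: homeomorphism_def)
qed (use assms in simp_all)

lemma in_components_of_separation:
  assumes "open G" "open H" "U \<subseteq> G \<union> H" "G \<inter> H \<inter> U = {}"
    and "connected (U \<inter> G)" "U \<inter> G \<noteq> {}"
  shows "U \<inter> G \<in> components U"
  unfolding in_components_maximal
proof (intro conjI allI impI)
  fix D assume D: "D \<noteq> {} \<and> U \<inter> G \<subseteq> D \<and> D \<subseteq> U \<and> connected D"
  have "G \<inter> D = {} \<or> H \<inter> D = {}"
    using connectedD[of D G H] D assms(1-4) by blast
  then show "D = U \<inter> G" using D assms by blast
qed (use assms in auto)

lemma split_link_sym: "split_link K L \<Longrightarrow> split_link L K"
  unfolding split_link_def by metis

text \<open>
  The rays of the boundary of the cone meet the boundary of the cube \<open>[-1, 1]\<^sup>4\<close> in finitely many polytopes: one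
  for each facet of the cube and each bounding hyperplane of the cone.
\<close>

lemma tame_cone_sphere:
  assumes "finite N" shows "tame (cone_sphere N)"
proof (rule tame_spherical_polyhedron)
  show "cone_sphere N \<subseteq> S3" by (auto simp: cone_sphere_def)
  define P :: "real^4 \<Rightarrow> 4 \<Rightarrow> real \<Rightarrow> (real^4) set" where
    "P n k s = (cbox (- 1) 1 \<inter> {x. axis k 1 \<bullet> x = s}) \<inter> ({x. n \<bullet> x = 0} \<inter> (\<Inter>m\<in>N. {x. m \<bullet> x \<ge> 0}))"
    for n k s
  define I where "I = N \<times> (UNIV::4 set) \<times> {-1, 1::real}"
  show "spherical_polyhedron (cone_sphere N)"
  proof (rule spherical_polyhedronI)
    show "finite ((\<lambda>(n,k,s). P n k s) ` I)" using assms by (simp add: I_def)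
  next
    fix Q assume "Q \<in> (\<lambda>(n,k,s). P n k s) ` I"
    then obtain n k s where Q: "Q = P n k s" "s \<in> {-1,1}" by (auto simp: I_def)
    show "polytope Q" unfolding polytope_eq_bounded_polyhedron
    proof
      show "polyhedron Q" unfolding Q P_def
        using assms by (intro polyhedron_Int polyhedron_hyperplane polyhedron_halfspace_ge polyhedron_Inter)
          (auto simp: polyhedron_halfspace_ge)
      show "bounded Q" unfolding Q P_def by (meson bounded_Int bounded_cbox)
    qed
    show "0 \<notin> Q" using Q by (auto simp: P_def)
  next
    show "cone_sphere N = (\<Union>Q\<in>(\<lambda>(n,k,s). P n k s) ` I. sgn ` Q)"
    proof (intro equalityI subsetI)
      fix x assume x: "x \<in> cone_sphere N"
      then obtain n where n: "n \<in> N" "n \<bullet> x = 0" and pos: "\<And>m. m \<in> N \<Longrightarrow> 0 \<le> m \<bullet> x" and nx: "norm x = 1"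
        by (auto simp: cone_sphere_def)
      obtain k where k: "\<And>j. \<bar>x $ j\<bar> \<le> \<bar>x $ k\<bar>"
        using ex_is_arg_min_if_finite[of "UNIV::4 set" "\<lambda>j. - \<bar>x $ j\<bar>"]
        by (auto simp: is_arg_min_linorder)
      have xk: "x $ k \<noteq> 0"
      proof
        assume "x $ k = 0"
        then have "x = 0" using k by (simp add: vec_eq_iff)
        then show False using nx by simp
      qed
      define y where "y = x /\<^sub>R \<bar>x $ k\<bar>"
      have "y \<in> P n k (sgn (x $ k))"
        using n pos abs_le_D1[OF k] abs_le_D2[OF k] xk
        by (auto simp: P_def y_def mem_box_cart inner_axis' field_simps sgn_real_def minus_le_iff)
      moreover have "sgn y = x"
        unfolding y_def using xk nx by (subst sgn_scaleR_pos) (auto simp: sgn_div_norm)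
      ultimately show "x \<in> (\<Union>Q\<in>(\<lambda>(n,k,s). P n k s) ` I. sgn ` Q)"
        using n xk by (auto simp: I_def sgn_real_def split: if_splits)
    next
      fix x assume "x \<in> (\<Union>Q\<in>(\<lambda>(n,k,s). P n k s) ` I. sgn ` Q)"
      then obtain n k s y where y: "n \<in> N" "s \<in> {-1,1}" "y \<in> P n k s" "x = sgn y"
        by (auto simp: I_def)
      then have "y \<noteq> 0" by (auto simp: P_def)
      then show "x \<in> cone_sphere N"
        using y by (auto simp: cone_sphere_def P_def norm_sgn sgn_div_norm)
    qed
  qed
qed

text \<open>
  The exterior of the cone is a union of open hemispheres. They all contain the point opposite to an interior
  point \<open>c\<close> of the cone.
\<close>

lemma connected_open_hemisphere_union:
  fixes c :: "real^4"
  assumes "\<And>n. n \<in> N \<Longrightarrow> 0 < n \<bullet> c"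
  shows "connected (S3 \<inter> {x. \<exists>n\<in>N. n \<bullet> x < 0})"
proof -
  define H where "H n = sgn ` {x. n \<bullet> x < 0}" for n :: "real^4"
  have H: "S3 \<inter> {x. n \<bullet> x < 0} = H n" for n
    unfolding H_def
  proof (intro equalityI subsetI)
    fix x assume "x \<in> S3 \<inter> {x. n \<bullet> x < 0}"
    then show "x \<in> sgn ` {x. n \<bullet> x < 0}" by (intro image_eqI[of _ _ x]) (auto simp: sgn_div_norm)
  next
    fix x assume "x \<in> sgn ` {x. n \<bullet> x < 0}"
    then obtain y where y: "x = sgn y" "n \<bullet> y < 0" by auto
    then have "y \<noteq> 0" by auto
    then show "x \<in> S3 \<inter> {x. n \<bullet> x < 0}" using y by (auto simp: norm_sgn sgn_div_norm mult_pos_neg)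
  qed
  have "connected (\<Union> (H ` N))"
  proof (rule connected_Union)
    show "connected S" if "S \<in> H ` N" for S
      using that unfolding H_def by (auto intro!: connected_sgn_image simp: convex_halfspace_lt)
    have "sgn (- c) \<in> H n" if "n \<in> N" for n
      unfolding H_def using assms[OF that] by (intro imageI) simp
    then have "sgn (- c) \<in> \<Inter> (H ` N)" by blast
    then show "\<Inter> (H ` N) \<noteq> {}" by blast
  qed
  moreover have "S3 \<inter> {x. \<exists>n\<in>N. n \<bullet> x < 0} = \<Union> (H ` N)" using H by blast
  ultimately show ?thesis by simp
qed

lemma connected_open_cone_trace:
  assumes "N \<noteq> {}"
  shows "connected (S3 \<inter> {x. \<forall>n\<in>N. 0 < n \<bullet> x})"
proof -
  have "S3 \<inter> {x. \<forall>n\<in>N. 0 < n \<bullet> x} = sgn ` {x. \<forall>n\<in>N. 0 < n \<bullet> x}"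
  proof (intro equalityI subsetI)
    fix x assume "x \<in> S3 \<inter> {x. \<forall>n\<in>N. 0 < n \<bullet> x}"
    then show "x \<in> sgn ` {x. \<forall>n\<in>N. 0 < n \<bullet> x}" by (intro image_eqI[of _ _ x]) (auto simp: sgn_div_norm)
  next
    fix x assume "x \<in> sgn ` {x. \<forall>n\<in>N. 0 < n \<bullet> x}"
    then obtain y where y: "x = sgn y" "\<forall>n\<in>N. 0 < n \<bullet> y" by auto
    then have "y \<noteq> 0" using assms by auto
    then show "x \<in> S3 \<inter> {x. \<forall>n\<in>N. 0 < n \<bullet> x}"
      using y by (auto simp: norm_sgn sgn_div_norm)
  qed
  moreover have "convex {x. \<forall>n\<in>N. 0 < n \<bullet> x}"
  proof -
    have "{x. \<forall>n\<in>N. 0 < n \<bullet> x} = (\<Inter>n\<in>N. {x. n \<bullet> x > 0})" by auto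
    then show ?thesis by (auto intro: convex_INT convex_halfspace_gt)
  qed
  ultimately show ?thesis using assms by (auto intro: connected_sgn_image)
qed

lemma continuous_on_Max_image:
  fixes f :: "'n \<Rightarrow> 'a::topological_space \<Rightarrow> real"
  assumes "finite N" "N \<noteq> {}" "\<And>n. n \<in> N \<Longrightarrow> continuous_on A (f n)"
  shows "continuous_on A (\<lambda>y. Max ((\<lambda>n. f n y) ` N))"
  using assms
proof (induction N rule: finite_ne_induct)
  case (insert n N)
  then have "Max ((\<lambda>n. f n y) ` insert n N) = max (f n y) (Max ((\<lambda>n. f n y) ` N))" for y by simp
  then show ?case using insert by (simp add: continuous_on_max)
qed simp

text \<open>
  Let \<open>c\<close> be an interior point of the cone. Every line parallel to \<open>c\<close> meets the boundary of the cone exactly once: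
  the line through \<open>y\<close> meets it at \<open>y + s y *\<^sub>R c\<close>, where \<open>s y\<close> is the least \<open>t\<close> for which \<open>y + t *\<^sub>R c\<close> lies in all
  half-spaces. Taking for \<open>y\<close> the unit vectors orthogonal to \<open>c\<close> parametrises the trace by a great 2-sphere.
\<close>

lemma cone_sphere_homeomorphic_sphere:
  fixes c :: "real^4"
  assumes N: "finite N" "N \<noteq> {}" and c: "\<And>n. n \<in> N \<Longrightarrow> 0 < n \<bullet> c"
  shows "cone_sphere N homeomorphic sphere (0::real^3) 1"
proof -
  have c0: "c \<noteq> 0" using c N(2) by auto
  define M where "M = {y. c \<bullet> y = 0 \<and> norm y = 1}"
  define s where "s y = Max ((\<lambda>n. - (n \<bullet> y) / (n \<bullet> c)) ` N)" for y
  define \<phi> where "\<phi> y = sgn (y + s y *\<^sub>R c)" for y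
  have s_ge: "0 \<le> n \<bullet> (y + t *\<^sub>R c) \<longleftrightarrow> - (n \<bullet> y) / (n \<bullet> c) \<le> t"
    and s_eq: "n \<bullet> (y + t *\<^sub>R c) = 0 \<longleftrightarrow> - (n \<bullet> y) / (n \<bullet> c) = t" if "n \<in> N" for n y t
    using c[OF that] by (auto simp: inner_add_right field_simps)
  have boundary: "(\<forall>n\<in>N. 0 \<le> n \<bullet> (y + t *\<^sub>R c)) \<and> (\<exists>n\<in>N. n \<bullet> (y + t *\<^sub>R c) = 0) \<longleftrightarrow> t = s y" for y t
  proof -
    have "t = s y \<longleftrightarrow> t \<in> (\<lambda>n. - (n \<bullet> y) / (n \<bullet> c)) ` N \<and> (\<forall>a\<in>(\<lambda>n. - (n \<bullet> y) / (n \<bullet> c)) ` N. a \<le> t)"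
      unfolding s_def by (rule eq_Max_iff) (use N in auto)
    then show ?thesis using s_ge s_eq by (auto simp: image_iff)
  qed
  have nz: "y + t *\<^sub>R c \<noteq> 0" if "y \<in> M" for y t
  proof
    assume "y + t *\<^sub>R c = 0"
    then have "y \<bullet> (y + t *\<^sub>R c) = 0" by simp
    then show False using that by (simp add: M_def inner_add_right inner_commute dot_square_norm)
  qed
  have "M homeomorphic cone_sphere N"
  proof (rule homeomorphic_compact)
    have "M = {y. c \<bullet> y = 0} \<inter> sphere 0 1" by (auto simp: M_def)
    then show "compact M" by (simp add: closed_hyperplane closed_Int_compact)
    have "continuous_on M s"
      unfolding s_def using N c by (intro continuous_on_Max_image continuous_intros) (auto dest: c)
    then have "continuous_on M (\<lambda>y. y + s y *\<^sub>R c)"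
      by (intro continuous_intros)
    moreover have "0 \<notin> (\<lambda>y. y + s y *\<^sub>R c) ` M" using nz by force
    ultimately have "continuous_on M (sgn \<circ> (\<lambda>y. y + s y *\<^sub>R c))"
      by (intro continuous_on_compose continuous_on_sgn_nonzero)
    then show "continuous_on M \<phi>" unfolding \<phi>_def[abs_def] o_def .
    show "\<phi> ` M = cone_sphere N"
    proof (intro equalityI subsetI)
      fix x assume "x \<in> \<phi> ` M"
      then obtain y where y: "y \<in> M" "x = sgn (y + s y *\<^sub>R c)" by (auto simp: \<phi>_def)
      let ?z = "y + s y *\<^sub>R c"
      have "(\<forall>n\<in>N. 0 \<le> n \<bullet> ?z) \<and> (\<exists>n\<in>N. n \<bullet> ?z = 0)" using boundary by blast
      then show "x \<in> cone_sphere N" using nz[OF y(1)] unfolding y(2) cone_sphere_def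
        by (auto simp: norm_sgn sgn_div_norm zero_le_mult_iff)
    next
      fix x assume x: "x \<in> cone_sphere N"
      define z where "z = x - ((c \<bullet> x) / (c \<bullet> c)) *\<^sub>R c"
      have cz: "c \<bullet> z = 0" using c0 by (simp add: z_def inner_diff_right)
      have "z \<noteq> 0"
      proof
        assume "z = 0"
        then have x': "x = ((c \<bullet> x) / (c \<bullet> c)) *\<^sub>R c" by (simp add: z_def)
        obtain n where "n \<in> N" "n \<bullet> x = 0" using x by (auto simp: cone_sphere_def)
        then have "(c \<bullet> x) / (c \<bullet> c) * (n \<bullet> c) = 0" by (subst (asm) x') simp
        then have "(c \<bullet> x) / (c \<bullet> c) = 0" using c[OF \<open>n \<in> N\<close>] by simp
        then have "x = 0" using x' by (metis scaleR_zero_left)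
        then show False using x by (auto simp: cone_sphere_def)
      qed
      define t where "t = (c \<bullet> x) / (c \<bullet> c) / norm z"
      have yM: "sgn z \<in> M" using cz \<open>z \<noteq> 0\<close> by (auto simp: M_def norm_sgn sgn_div_norm)
      have xz: "sgn z + t *\<^sub>R c = x /\<^sub>R norm z"
        using \<open>z \<noteq> 0\<close> by (simp add: t_def z_def sgn_div_norm algebra_simps divide_inverse)
      have "t = s (sgn z)"
        unfolding boundary[symmetric] xz using x \<open>z \<noteq> 0\<close> by (auto simp: cone_sphere_def)
      then have "\<phi> (sgn z) = sgn (x /\<^sub>R norm z)" unfolding \<phi>_def using xz by simp
      also have "\<dots> = x" using \<open>z \<noteq> 0\<close> x by (subst sgn_scaleR_pos) (auto simp: cone_sphere_def sgn_div_norm)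
      finally show "x \<in> \<phi> ` M" using yM by blast
    qed
    show "inj_on \<phi> M"
    proof (rule inj_onI)
      fix y y' assume y: "y \<in> M" "y' \<in> M" "\<phi> y = \<phi> y'"
      obtain k where k: "0 < k" "y + s y *\<^sub>R c = k *\<^sub>R (y' + s y' *\<^sub>R c)"
        using sgn_eqD[OF y(3)[unfolded \<phi>_def] nz[OF y(1)] nz[OF y(2)]] by blast
      have "c \<bullet> (y + s y *\<^sub>R c) = c \<bullet> (k *\<^sub>R (y' + s y' *\<^sub>R c))" using k by simp
      then have "s y = k * s y'" using y c0 by (simp add: M_def inner_add_right)
      then have "y = k *\<^sub>R y'" using k(2) by (simp add: algebra_simps)
      moreover have "norm y = 1" "norm y' = 1" using y by (auto simp: M_def)
      ultimately have "k = 1" using k(1) by simp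
      then show "y = y'" using \<open>y = k *\<^sub>R y'\<close> by simp
    qed
  qed
  moreover have "M homeomorphic sphere (0::real^3) 1"
  proof -
    have "dim {y. c \<bullet> y = 0} = dim (UNIV :: (real^3) set)"
      using dim_hyperplane[OF c0] by simp
    then obtain f :: "real^4 \<Rightarrow> real^3" and g where fg: "linear f" "linear g" "f ` {y. c \<bullet> y = 0} = UNIV"
      "g ` UNIV = {y. c \<bullet> y = 0}" "\<And>x. x \<in> {y. c \<bullet> y = 0} \<Longrightarrow> norm (f x) = norm x"
      "\<And>x. x \<in> UNIV \<Longrightarrow> norm (g x) = norm x" "\<And>x. x \<in> {y. c \<bullet> y = 0} \<Longrightarrow> g (f x) = x"
      "\<And>x. x \<in> UNIV \<Longrightarrow> f (g x) = x"
      by (rule isometries_subspaces[OF subspace_hyperplane[of c] subspace_UNIV]) (rule that; assumption)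
    show ?thesis
    proof (rule homeomorphicI)
      show "f ` M = sphere 0 1"
      proof (intro equalityI subsetI)
        fix x :: "real^3" assume "x \<in> sphere 0 1"
        then have "g x \<in> M" "x = f (g x)" using fg(4,6,8) by (auto simp: M_def)
        then show "x \<in> f ` M" by blast
      qed (use fg(5) in \<open>auto simp: M_def\<close>)
      show "g ` sphere 0 1 = M"
      proof (intro equalityI subsetI)
        fix x assume "x \<in> M"
        then have "f x \<in> sphere 0 1" "x = g (f x)" using fg(5,7) by (auto simp: M_def)
        then show "x \<in> g ` sphere 0 1" by blast
      qed (use fg(4,6) in \<open>auto simp: M_def\<close>)
      show "continuous_on M f" "continuous_on (sphere 0 1) g"
        using fg(1,2) by (simp_all add: linear_continuous_on linear_linear)
    qed (use fg(7,8) in \<open>auto simp: M_def\<close>)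
  qed
  ultimately show ?thesis by (metis homeomorphic_sym homeomorphic_trans)
qed

text \<open>
  The two components of the complement of the 2-sphere are the interior and the exterior of the cone.
\<close>

lemma split_by_cone:
  fixes c :: "real^4"
  assumes N: "finite N" "N \<noteq> {}" and c: "\<And>n. n \<in> N \<Longrightarrow> 0 < n \<bullet> c"
    and K: "K \<subseteq> S3" "\<And>x n. x \<in> K \<Longrightarrow> n \<in> N \<Longrightarrow> 0 < n \<bullet> x"
    and L: "L \<subseteq> S3" "\<And>x. x \<in> L \<Longrightarrow> \<exists>n\<in>N. n \<bullet> x < 0"
  shows "split_link K L"
proof -
  define U where "U = S3 - cone_sphere N"
  define G where "G = {x::real^4. \<forall>n\<in>N. 0 < n \<bullet> x}"
  define H where "H = {x::real^4. \<exists>n\<in>N. n \<bullet> x < 0}"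
  have op: "open G" "open H"
  proof -
    have "G = (\<Inter>n\<in>N. {x. n \<bullet> x > 0})" "H = (\<Union>n\<in>N. {x. n \<bullet> x < 0})" by (auto simp: G_def H_def)
    then show "open G" "open H" using N by (auto intro!: open_INT open_UN open_halfspace_gt open_halfspace_lt)
  qed
  have "U \<subseteq> G \<union> H"
  proof
    fix x assume x: "x \<in> U"
    show "x \<in> G \<union> H"
    proof (cases "x \<in> H")
      case False
      then have "\<forall>n\<in>N. 0 \<le> n \<bullet> x" by (auto simp: H_def not_less)
      then have "\<forall>n\<in>N. n \<bullet> x \<noteq> 0" using x by (auto simp: U_def cone_sphere_def)
      then show ?thesis using \<open>\<forall>n\<in>N. 0 \<le> n \<bullet> x\<close> by (auto simp: G_def less_le)
    qed simp
  qed
  moreover have "G \<inter> H = {}" by (auto simp: G_def H_def dest: less_asym)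
  ultimately have U: "U \<subseteq> G \<union> H" "U \<subseteq> H \<union> G" "G \<inter> H \<inter> U = {}" "H \<inter> G \<inter> U = {}" by blast+
  have UG: "U \<inter> G = S3 \<inter> G" and UH: "U \<inter> H = S3 \<inter> H"
    by (auto simp: U_def G_def H_def cone_sphere_def)
  have c0: "c \<noteq> 0" using c N(2) by auto
  have "sgn c \<in> S3 \<inter> G" "sgn (- c) \<in> S3 \<inter> H"
    using c c0 N(2) by (auto simp: G_def H_def norm_sgn sgn_div_norm)
  then have ne: "U \<inter> G \<noteq> {}" "U \<inter> H \<noteq> {}" unfolding UG UH by blast+
  have "connected (U \<inter> G)" unfolding UG unfolding G_def by (rule connected_open_cone_trace[OF N(2)])
  then have CG: "U \<inter> G \<in> components U" using op U ne by (intro in_components_of_separation[of G H])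
  have "connected (U \<inter> H)" unfolding UH unfolding H_def using c by (rule connected_open_hemisphere_union)
  then have CH: "U \<inter> H \<in> components U" using op U ne by (intro in_components_of_separation[of H G])
  have "U \<inter> G \<noteq> U \<inter> H" using U(3) ne by blast
  moreover have "K \<subseteq> U \<inter> G" "L \<subseteq> U \<inter> H" unfolding UG UH using K L by (auto simp: G_def H_def)
  ultimately show ?thesis unfolding split_link_def U_def[symmetric]
    using tame_cone_sphere[OF N(1)] cone_sphere_homeomorphic_sphere[OF N c] CG[unfolded U_def] CH[unfolded U_def]
    by (intro exI[of _ "cone_sphere N"] conjI bexI[of _ "U \<inter> G"] bexI[of _ "U \<inter> H"]) (simp_all add: U_def)
qed

section \<open>Drawing a tournament on the moment curve\<close>

definition moment_curve :: "real \<Rightarrow> real^4" where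
  "moment_curve t = vector [1, t, t^2, t^3]"

lemma vector_4:
  "(vector [w, x, y, z] :: 'a::zero^4) $ 1 = w" "(vector [w, x, y, z] :: 'a::zero^4) $ 2 = x"
  "(vector [w, x, y, z] :: 'a::zero^4) $ 3 = y" "(vector [w, x, y, z] :: 'a::zero^4) $ 4 = z"
  by (simp_all add: vector_def)

lemma moment_nth [simp]:
  "moment_curve t $ 1 = 1" "moment_curve t $ 2 = t" "moment_curve t $ 3 = t^2" "moment_curve t $ 4 = t^3"
  by (simp_all add: moment_curve_def vector_4)

lemma cubic_functional:
  obtains n :: "real^4" where "\<And>t. n \<bullet> moment_curve t = a + b * t + c * t^2 + d * t^3"
proof
  show "vector [a, b, c, d] \<bullet> moment_curve t = a + b * t + c * t^2 + d * t^3" for t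
    by (simp add: inner_vec_def sum_4 vector_4)
qed

lemma cubic_functional_roots:
  obtains n :: "real^4" where "\<And>t. n \<bullet> moment_curve t = (t - p) * (t - q) * (t - r)"
proof -
  obtain n :: "real^4" where "\<And>t. n \<bullet> moment_curve t = - (p*q*r) + (p*q + q*r + p*r) * t + (- (p+q+r)) * t^2 + 1 * t^3"
    using cubic_functional by blast
  then show ?thesis using that[of n] by (simp add: algebra_simps power2_eq_square power3_eq_cube)
qed

text \<open>
  Four different points of the moment curve are linearly independent, so chords meet at common ends only.
  Concretely, the cubic with roots \<open>a\<close>, \<open>b\<close> and \<open>c\<close> vanishes on the chord from \<open>a\<close> to \<open>b\<close>; at a common
  point with the chord from \<open>c\<close> to \<open>d\<close> this forces it to vanish at \<open>d\<close>, too.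
\<close>

lemma moment_segments_cross_only_at_ends:
  assumes "(1 - s) *\<^sub>R moment_curve a + s *\<^sub>R moment_curve b = (1 - r) *\<^sub>R moment_curve c + r *\<^sub>R moment_curve d"
    and "0 < r" "r < 1" "c \<noteq> d"
  shows "c \<in> {a, b} \<and> d \<in> {a, b}"
proof -
  have *: "((1 - r) * ((c - a) * (c - b) * (c - q)) + r * ((d - a) * (d - b) * (d - q))) = 0" for q
  proof -
    obtain n :: "real^4" where n: "\<And>t. n \<bullet> moment_curve t = (t - a) * (t - b) * (t - q)"
      using cubic_functional_roots by blast
    from assms(1) have "n \<bullet> ((1 - s) *\<^sub>R moment_curve a + s *\<^sub>R moment_curve b) = n \<bullet> ((1 - r) *\<^sub>R moment_curve c + r *\<^sub>R moment_curve d)"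
      by simp
    then show ?thesis by (simp add: n inner_add_right)
  qed
  show ?thesis using *[of c] *[of d] assms(2-4) by auto
qed

text \<open>
  If the ends of \<open>e\<close> do not belong to \<open>A\<close>, this says that the chord \<open>e\<close> of the moment curve meets the convex
  hull of the vertices \<open>A\<close>.
\<close>

definition pierces :: "nat \<times> nat \<Rightarrow> nat set \<Rightarrow> bool" where
  "pierces e A \<longleftrightarrow> (\<exists>x\<in>A. x < min (fst e) (snd e)) \<and>
     (\<exists>y\<in>A. min (fst e) (snd e) < y \<and> y < max (fst e) (snd e)) \<and> (\<exists>z\<in>A. max (fst e) (snd e) < z)"

text \<open>
  If \<open>A\<close> avoids one of the three intervals before, between and after \<open>b\<close> and \<open>b'\<close>, three sign changes are enough
  for a cubic polynomial to be negative at \<open>b\<close> and \<open>b'\<close> and positive on \<open>A\<close>. As the vertices have integral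
  parameters, the roots can be taken at distance \<open>1/2\<close> from \<open>b\<close> and \<open>b'\<close>.
\<close>

lemma cubic_separation:
  assumes "\<not> pierces (b, b') A" "b \<noteq> b'" "b \<notin> A" "b' \<notin> A"
  obtains n :: "real^4" where "\<And>a. a \<in> A \<Longrightarrow> 0 < n \<bullet> moment_curve (real a)"
    "n \<bullet> moment_curve (real b) < 0" "n \<bullet> moment_curve (real b') < 0"
proof -
  note that_n = that
  define u where "u = min b b'"
  define v where "v = max b b'"
  have uv: "u < v" "u \<notin> A" "v \<notin> A" "{b, b'} = {u, v}" using assms by (auto simp: u_def v_def min_def max_def)
  have sep: thesis if "\<And>a. a \<in> A \<Longrightarrow> 0 < m \<bullet> moment_curve (real a)"
    "m \<bullet> moment_curve (real u) < 0" "m \<bullet> moment_curve (real v) < 0" for m :: "real^4"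
    using uv(4) that(2,3) by (intro that_n[of m] that(1)) (auto simp: doubleton_eq_iff)
  have sq: "1 / 4 < (real x - real y)^2" if "x \<noteq> y" for x y :: nat
  proof -
    have "1 \<le> \<bar>real x - real y\<bar>" using that by linarith
    then have "1\<^sup>2 \<le> \<bar>real x - real y\<bar>\<^sup>2" by (intro power_mono) auto
    then show ?thesis by simp
  qed
  define p q where "p = real u" and "q = real v"
  have pq: "p + 1 \<le> q" using uv(1) by (simp add: p_def q_def)
  have sq_pq: "1 / 4 < (p - q)\<^sup>2" "1 / 4 < (q - p)\<^sup>2"
    using sq uv(1) by (simp_all add: p_def q_def)
  \<comment> \<open>no element of \<open>A\<close> comes before, between or after the ends, respectively\<close>
  consider "\<forall>x\<in>A. u < x" | "\<forall>x\<in>A. x < u \<or> v < x" | "\<forall>x\<in>A. x < v"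
    using assms(1) uv(1-3) unfolding pierces_def fst_conv snd_conv u_def[symmetric] v_def[symmetric]
    by (metis linorder_neqE_nat)
  then show thesis
  proof cases
    case 1
    obtain m :: "real^4" where m: "\<And>t. m \<bullet> moment_curve t = (t - (p + 1/2)) * (t - (q - 1/2)) * (t - (q + 1/2))"
      using cubic_functional_roots by blast
    have m': "m \<bullet> moment_curve t = (t - p - 1/2) * ((t - q)^2 - 1/4)" for t
      unfolding m by (simp add: algebra_simps power2_eq_square)
    show thesis
    proof (rule sep[of m])
      fix a assume a: "a \<in> A"
      then have "p + 1 \<le> real a" "1 / 4 < (real a - q)\<^sup>2"
        using 1 uv(3) sq[of a v] by (force simp: p_def q_def)+
      then show "0 < m \<bullet> moment_curve (real a)" unfolding m' by (intro mult_pos_pos) auto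
    next
      show "m \<bullet> moment_curve (real u) < 0" using sq_pq unfolding p_def[symmetric] m' by (intro mult_neg_pos) auto
      show "m \<bullet> moment_curve (real v) < 0" using pq unfolding q_def[symmetric] m' by (intro mult_pos_neg) auto
    qed
  next
    case 2
    obtain m :: "real^4" where m: "\<And>t. m \<bullet> moment_curve t = (p - 1/2) * (q + 1/2) + (- (p + q)) * t + 1 * t^2 + 0 * t^3"
      using cubic_functional by blast
    have m': "m \<bullet> moment_curve t = (t - p + 1/2) * (t - q - 1/2)" for t
      unfolding m by (simp add: algebra_simps power2_eq_square)
    show thesis
    proof (rule sep[of m])
      fix a assume "a \<in> A"
      then consider "real a + 1 \<le> p" | "q + 1 \<le> real a" using 2 by (force simp: p_def q_def)
      then show "0 < m \<bullet> moment_curve (real a)"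
        by cases (use pq in \<open>auto simp: m' intro: mult_pos_pos mult_neg_neg\<close>)
    next
      show "m \<bullet> moment_curve (real u) < 0" using pq unfolding p_def[symmetric] m' by (intro mult_pos_neg) auto
      show "m \<bullet> moment_curve (real v) < 0" using pq unfolding q_def[symmetric] m' by (intro mult_pos_neg) auto
    qed
  next
    case 3
    obtain m :: "real^4" where m: "\<And>t. m \<bullet> moment_curve t = (t - (q - 1/2)) * (t - (p - 1/2)) * (t - (p + 1/2))"
      using cubic_functional_roots by blast
    have m': "(- m) \<bullet> moment_curve t = (q - t - 1/2) * ((t - p)^2 - 1/4)" for t
      unfolding inner_minus_left m by (simp add: algebra_simps power2_eq_square)
    show thesis
    proof (rule sep[of "- m"])
      fix a assume a: "a \<in> A"
      then have "real a + 1 \<le> q" "1 / 4 < (real a - p)\<^sup>2"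
        using 3 uv(2) sq[of a u] by (force simp: p_def q_def)+
      then show "0 < - m \<bullet> moment_curve (real a)" unfolding m' by (intro mult_pos_pos) auto
    next
      show "- m \<bullet> moment_curve (real u) < 0" using pq unfolding p_def[symmetric] m' by (intro mult_pos_neg) auto
      show "- m \<bullet> moment_curve (real v) < 0" using sq_pq unfolding q_def[symmetric] m' by (intro mult_neg_pos) auto
    qed
  qed
qed

definition moment_vertex :: "('a \<Rightarrow> nat) \<Rightarrow> 'a \<Rightarrow> real^4" where
  "moment_vertex pos v = sgn (moment_curve (real (pos v)))"

definition moment_arc :: "('a, 'b) pre_digraph \<Rightarrow> ('a \<Rightarrow> nat) \<Rightarrow> 'b \<Rightarrow> real \<Rightarrow> real^4" where
  "moment_arc G pos e = sgn \<circ> linepath (moment_curve (real (pos (tail G e)))) (moment_curve (real (pos (head G e))))"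

text \<open>
  The moment curve lies in the affine hyperplane of points with first coordinate 1. Radial projection is injective
  there, so that the drawing inherits its incidences from the chords.
\<close>

lemma inj_on_sgn_affine: "inj_on sgn {x :: real^4. x $ 1 = 1}"
proof (rule inj_onI)
  fix x y :: "real^4" assume xy: "x \<in> {x. x $ 1 = 1}" "y \<in> {x. x $ 1 = 1}" "sgn x = sgn y"
  then have "x \<noteq> 0" "y \<noteq> 0" by auto
  then obtain k where "x = k *\<^sub>R y" using sgn_eqD xy(3) by blast
  then show "x = y" using xy by auto
qed

lemma linepath_moment_1 [simp]: "linepath (moment_curve a) (moment_curve b) s $ 1 = 1"
  by (simp add: linepath_def)

lemma graph_embedding_moment:
  assumes "tournament G" "inj_on pos (verts G)"
  shows "graph_embedding G (moment_vertex pos) (moment_arc G pos)"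
proof -
  have dig: "digraph G" using assms by (simp add: tournament_def)
  interpret digraph G by (rule dig)
  have norm1: "norm (sgn x) = 1" if "x $ 1 = 1" for x :: "real^4" using that by (auto simp: norm_sgn)
  have ends: "pos (tail G e) \<noteq> pos (head G e)" if "e \<in> arcs G" for e
    using that assms(2) no_loops[OF that] by (auto dest: inj_onD)
  have par: "e = e'" if "e \<in> arcs G" "e' \<in> arcs G" "{pos (tail G e'), pos (head G e')} \<subseteq> {pos (tail G e), pos (head G e)}" for e e'
  proof -
    have "{tail G e', head G e'} = {tail G e, head G e}"
      using that ends[OF that(1)] ends[OF that(2)] assms(2) tail_in_verts[OF that(1)] tail_in_verts[OF that(2)]
         head_in_verts[OF that(1)] head_in_verts[OF that(2)]
      by (auto simp: inj_on_eq_iff doubleton_eq_iff)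
    moreover have "\<exists>!a. a \<in> arcs G \<and> {tail G a, head G a} = {tail G e, head G e}"
      using assms(1) that no_loops[OF that(1)] unfolding tournament_def by auto
    ultimately show ?thesis using that by blast
  qed
  have cross: "pos (tail G e) \<in> {a, b} \<and> pos (head G e) \<in> {a, b}"
    if "e \<in> arcs G" "r \<in> {0<..<1}" "moment_arc G pos e r = sgn (linepath (moment_curve (real a)) (moment_curve (real b)) s)" for e r s a b
  proof -
    have "linepath (moment_curve (real a)) (moment_curve (real b)) s = linepath (moment_curve (real (pos (tail G e)))) (moment_curve (real (pos (head G e)))) r"
      using inj_onD[OF inj_on_sgn_affine, of "linepath (moment_curve (real a)) (moment_curve (real b)) s" "linepath (moment_curve (real (pos (tail G e)))) (moment_curve (real (pos (head G e)))) r"] that(3)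
      by (simp add: moment_arc_def)
    then show ?thesis
      using moment_segments_cross_only_at_ends[of s "real a" "real b" r "real (pos (tail G e))" "real (pos (head G e))"] that(2) ends[OF that(1)]
      by (auto simp: linepath_def)
  qed
  show ?thesis unfolding graph_embedding_def
  proof (intro conjI ballI impI)
    show "embedding_image G (moment_vertex pos) (moment_arc G pos) \<subseteq> S3"
      by (auto simp: embedding_image_def moment_vertex_def path_image_def moment_arc_def intro!: norm1)
    show "inj_on (moment_vertex pos) (verts G)"
    proof (rule inj_onI)
      fix u v assume uv: "u \<in> verts G" "v \<in> verts G" "moment_vertex pos u = moment_vertex pos v"
      then have "moment_curve (real (pos u)) = moment_curve (real (pos v))"
        using inj_onD[OF inj_on_sgn_affine] by (simp add: moment_vertex_def)
      then have "moment_curve (real (pos u)) $ 2 = moment_curve (real (pos v)) $ 2" by simp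
      then show "u = v" using uv assms(2) by (simp add: inj_on_eq_iff)
    qed
  next
    fix e assume e: "e \<in> arcs G"
    have "moment_curve (real (pos (tail G e))) \<noteq> moment_curve (real (pos (head G e)))"
    proof
      assume "moment_curve (real (pos (tail G e))) = moment_curve (real (pos (head G e)))"
      then have "moment_curve (real (pos (tail G e))) $ 2 = moment_curve (real (pos (head G e))) $ 2" by simp
      then show False using ends[OF e] by simp
    qed
    then show "simple_path (moment_arc G pos e)"
      unfolding moment_arc_def
    proof (intro simple_path_continuous_image simple_path_linepath)
      have *: "path_image (linepath (moment_curve a) (moment_curve b)) \<subseteq> {x. x $ 1 = 1}" for a b
        by (auto simp: path_image_def)
      show "inj_on sgn (path_image (linepath (moment_curve (real (pos (tail G e)))) (moment_curve (real (pos (head G e))))))"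
        by (rule inj_on_subset[OF inj_on_sgn_affine *])
      show "continuous_on (path_image (linepath (moment_curve (real (pos (tail G e)))) (moment_curve (real (pos (head G e)))))) sgn"
        using * by (intro continuous_on_sgn_nonzero) force
    qed
    show "pathstart (moment_arc G pos e) = moment_vertex pos (tail G e)"
      "pathfinish (moment_arc G pos e) = moment_vertex pos (head G e)"
      by (simp_all add: moment_arc_def moment_vertex_def pathstart_compose pathfinish_compose)
    show "moment_arc G pos e ` {0<..<1} \<inter> moment_vertex pos ` verts G = {}"
    proof (rule ccontr)
      assume "\<not> ?thesis"
      then obtain r v where "r \<in> {0<..<1}" "moment_arc G pos e r = sgn (linepath (moment_curve (real (pos v))) (moment_curve (real (pos v))) 0)"
        unfolding moment_vertex_def by (auto simp del: greaterThanLessThan_iff)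
      from cross[OF e this] show False using ends[OF e] by auto
    qed
  next
    fix e e' assume e: "e \<in> arcs G" "e' \<in> arcs G" "e \<noteq> e'"
    show "moment_arc G pos e ` {0<..<1} \<inter> moment_arc G pos e' ` {0<..<1} = {}"
    proof (rule ccontr)
      assume "\<not> ?thesis"
      then obtain r s where "r \<in> {0<..<1}" "s \<in> {0<..<1}" "moment_arc G pos e r = moment_arc G pos e' s"
        by (auto simp del: greaterThanLessThan_iff)
      then have "{pos (tail G e), pos (head G e)} \<subseteq> {pos (tail G e'), pos (head G e')}"
        using cross[OF e(1), of r "pos (tail G e')" "pos (head G e')" s] by (auto simp: moment_arc_def)
      then show False using par e by blast
    qed
  qed
qed

lemma path_image_moment_arc:
  "path_image (moment_arc G pos e) = sgn ` closed_segment (moment_curve (real (pos (tail G e)))) (moment_curve (real (pos (head G e))))"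
  by (simp add: moment_arc_def path_image_compose)

lemma zero_notin_moment_segment [simp]: "0 \<notin> closed_segment (moment_curve a) (moment_curve b)"
proof
  assume "0 \<in> closed_segment (moment_curve a) (moment_curve b)"
  then obtain u where "0 = (1 - u) *\<^sub>R moment_curve a + u *\<^sub>R moment_curve b" by (auto simp: in_segment)
  then have "0 $ 1 = ((1 - u) *\<^sub>R moment_curve a + u *\<^sub>R moment_curve b) $ 1" by simp
  then show False by simp
qed

lemma moment_neq_0 [simp]: "moment_curve a \<noteq> 0"
  using zero_notin_moment_segment[of a a] by auto

lemma tame_moment_embedding:
  assumes "finite (verts G)" "finite (arcs G)"
  shows "tame (embedding_image G (moment_vertex pos) (moment_arc G pos))"
proof (rule tame_spherical_polyhedron)
  show "embedding_image G (moment_vertex pos) (moment_arc G pos) \<subseteq> S3"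
    by (auto simp: embedding_image_def moment_vertex_def path_image_moment_arc norm_sgn)
  show "spherical_polyhedron (embedding_image G (moment_vertex pos) (moment_arc G pos))"
  proof (rule spherical_polyhedronI)
    let ?P = "(\<lambda>v. {moment_curve (real (pos v))}) ` verts G \<union>
      (\<lambda>e. closed_segment (moment_curve (real (pos (tail G e)))) (moment_curve (real (pos (head G e))))) ` arcs G"
    show "finite ?P" using assms by simp
    show "polytope P" if "P \<in> ?P" for P using that by (auto simp: segment_convex_hull polytope_convex_hull polytope_sing)
    show "0 \<notin> P" if "P \<in> ?P" for P
      using that by auto
    show "embedding_image G (moment_vertex pos) (moment_arc G pos) = (\<Union>P\<in>?P. sgn ` P)"
      by (auto simp: embedding_image_def moment_vertex_def path_image_moment_arc)
  qed
qed

lemma inner_sgn_segment: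
  fixes n :: "real^4"
  assumes "x \<in> sgn ` closed_segment y z"
  shows "0 < n \<bullet> y \<Longrightarrow> 0 < n \<bullet> z \<Longrightarrow> 0 < n \<bullet> x" "n \<bullet> y < 0 \<Longrightarrow> n \<bullet> z < 0 \<Longrightarrow> n \<bullet> x < 0"
proof -
  obtain w where w: "w \<in> closed_segment y z" "x = sgn w" using assms by auto
  have seg: "w \<in> S" if "y \<in> S" "z \<in> S" "convex S" for S using that w(1) closed_segment_subset by blast
  show "0 < n \<bullet> x" if "0 < n \<bullet> y" "0 < n \<bullet> z"
  proof -
    have "0 < n \<bullet> w" using seg[of "{u. n \<bullet> u > 0}"] that convex_halfspace_gt by blast
    moreover then have "w \<noteq> 0" by auto
    ultimately show ?thesis by (simp add: w(2) sgn_div_norm)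
  qed
  show "n \<bullet> x < 0" if "n \<bullet> y < 0" "n \<bullet> z < 0"
  proof -
    have "n \<bullet> w < 0" using seg[of "{u. n \<bullet> u < 0}"] that convex_halfspace_lt by blast
    moreover then have "w \<noteq> 0" by auto
    ultimately show ?thesis by (simp add: w(2) sgn_div_norm mult_pos_neg)
  qed
qed

text \<open>
  Each arc of \<open>d\<close> is cut off from \<open>A\<close> by a linear functional of its own. The functionals together define the
  cone: \<open>c\<close> lies where all of them are positive, and each point of \<open>d\<close> lies where one of them is negative.
\<close>

lemma split_link_moment_cycles:
  fixes c d :: "'b list" and G :: "('a, 'b) pre_digraph"
  assumes "c \<noteq> []" "d \<noteq> []" "\<And>e. e \<in> set c \<Longrightarrow> pos (tail G e) \<in> A \<and> pos (head G e) \<in> A"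
    and "\<And>e. e \<in> set d \<Longrightarrow> pos (tail G e) \<notin> A \<and> pos (head G e) \<notin> A \<and> pos (tail G e) \<noteq> pos (head G e)"
    and "\<And>e. e \<in> set d \<Longrightarrow> \<not> pierces (pos (tail G e), pos (head G e)) A"
  shows "split_link (cycle_image (moment_arc G pos) c) (cycle_image (moment_arc G pos) d)"
proof -
  have "\<forall>e\<in>set d. \<exists>n :: real^4. (\<forall>a\<in>A. 0 < n \<bullet> moment_curve (real a)) \<and>
      n \<bullet> moment_curve (real (pos (tail G e))) < 0 \<and> n \<bullet> moment_curve (real (pos (head G e))) < 0"
    using assms(4,5) by (metis cubic_separation)
  then obtain n :: "'b \<Rightarrow> real^4" where n: "\<And>e a. e \<in> set d \<Longrightarrow> a \<in> A \<Longrightarrow> 0 < n e \<bullet> moment_curve (real a)"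
      "\<And>e. e \<in> set d \<Longrightarrow> n e \<bullet> moment_curve (real (pos (tail G e))) < 0"
      "\<And>e. e \<in> set d \<Longrightarrow> n e \<bullet> moment_curve (real (pos (head G e))) < 0" by metis
  have sph: "cycle_image (moment_arc G pos) b \<subseteq> S3" for b
    by (auto simp: cycle_image_def path_image_moment_arc norm_sgn)

  show ?thesis
  proof (rule split_by_cone[of "n ` set d" "moment_curve (real (pos (tail G (hd c))))"])
    show "n ` set d \<noteq> {}" using assms(2) by simp
    show "0 < m \<bullet> moment_curve (real (pos (tail G (hd c))))" if "m \<in> n ` set d" for m
      using that n(1) assms(1,3) by auto
    show "0 < m \<bullet> x" if x: "x \<in> cycle_image (moment_arc G pos) c" and m: "m \<in> n ` set d" for x m
    proof -
      obtain e where e: "e \<in> set c" "x \<in> sgn ` closed_segment (moment_curve (real (pos (tail G e)))) (moment_curve (real (pos (head G e))))"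
        using x unfolding cycle_image_def path_image_moment_arc by blast
      then show ?thesis using inner_sgn_segment(1)[OF e(2)] n(1) assms(3)[OF e(1)] m by auto
    qed
    show "\<exists>m\<in>n ` set d. m \<bullet> x < 0" if x: "x \<in> cycle_image (moment_arc G pos) d" for x
    proof -
      obtain e where e: "e \<in> set d" "x \<in> sgn ` closed_segment (moment_curve (real (pos (tail G e)))) (moment_curve (real (pos (head G e))))"
        using x unfolding cycle_image_def path_image_moment_arc by blast
      then show ?thesis using inner_sgn_segment(2)[OF e(2)] n(2,3) by auto
    qed
  qed (use sph in auto)
qed

section \<open>Alternating cyclic vertex sets\<close>

definition alternate :: "nat set \<Rightarrow> nat set \<Rightarrow> bool" where
  "alternate A B \<longleftrightarrow> (\<exists>a\<in>A. \<exists>b\<in>B. \<exists>c\<in>A. \<exists>d\<in>B. \<exists>e\<in>A. \<exists>f\<in>B. a < b \<and> b < c \<and> c < d \<and> d < e \<and> e < f)"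

text \<open>
  The vertex set of a directed cycle has this property. Unlike the cycle itself, it is described by its membership
  statements, which makes the finite checks below propositional.
\<close>

definition cyclic_set :: "('a \<Rightarrow> 'a \<Rightarrow> bool) \<Rightarrow> 'a set \<Rightarrow> bool" where
  "cyclic_set E A \<longleftrightarrow> (\<forall>v\<in>A. (\<exists>u\<in>A. E v u) \<and> (\<exists>u\<in>A. E u v))"

definition untangled :: "nat \<Rightarrow> (nat \<Rightarrow> nat \<Rightarrow> bool) \<Rightarrow> bool" where
  "untangled n E \<longleftrightarrow> (\<forall>A B. cyclic_set E A \<longrightarrow> cyclic_set E B \<longrightarrow> A \<subseteq> {..<n} \<longrightarrow> B \<subseteq> {..<n} \<longrightarrow>
     A \<inter> B = {} \<longrightarrow> \<not> alternate A B)"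

lemma untangled_converse: "untangled n (\<lambda>i j. E j i) \<longleftrightarrow> untangled n E"
proof -
  have "cyclic_set (\<lambda>i j. E j i) A \<longleftrightarrow> cyclic_set E A" for A by (auto simp: cyclic_set_def)
  then show ?thesis by (simp add: untangled_def)
qed

text \<open>
  Each piercing yields five alternating vertices, one chain starting and ending in \<open>A\<close> and one starting and
  ending in \<open>B\<close>. Whichever of the chains starts later can be preceded by the first vertex of the other one.
\<close>

lemma alternate_if_mutually_piercing:
  assumes "pierces (b, b') A" "b \<in> B" "b' \<in> B" "pierces (a, a') B" "a \<in> A" "a' \<in> A" "A \<inter> B = {}"
  shows "alternate A B \<or> alternate B A"
proof -
  have three: thesis if "pierces (w, w') X" "w \<in> Y" "w' \<in> Y"
    "\<And>x u y v z. x \<in> X \<Longrightarrow> u \<in> Y \<Longrightarrow> y \<in> X \<Longrightarrow> v \<in> Y \<Longrightarrow> z \<in> X \<Longrightarrow> x < u \<Longrightarrow> u < y \<Longrightarrow> y < v \<Longrightarrow> v < z \<Longrightarrow> thesis"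
    for X Y :: "nat set" and w w' thesis
  proof -
    have "min w w' \<in> Y" "max w w' \<in> Y" using that(2,3) by (auto simp: min_def max_def)
    then show thesis using that(1,4) unfolding pierces_def by auto
  qed
  obtain x u y v z where 1: "x \<in> A" "u \<in> B" "y \<in> A" "v \<in> B" "z \<in> A" "x < u" "u < y" "y < v" "v < z"
    by (rule three[OF assms(1-3)])
  obtain x' u' y' v' z' where 2: "x' \<in> B" "u' \<in> A" "y' \<in> B" "v' \<in> A" "z' \<in> B" "x' < u'" "u' < y'" "y' < v'" "v' < z'"
    by (rule three[OF assms(4-6)])
  have "x \<noteq> x'" using 1(1) 2(1) assms(7) by auto
  then consider "x < x'" | "x' < x" by linarith
  then show ?thesis
  proof cases
    case 1
    then have "alternate A B" unfolding alternate_def using \<open>x \<in> A\<close> 2 by (intro bexI conjI)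
    then show ?thesis ..
  next
    case 2
    then have "alternate B A" unfolding alternate_def using \<open>x' \<in> B\<close> 1 by (intro bexI conjI)
    then show ?thesis ..
  qed
qed

lemma cycle_arc_lists:
  assumes "pre_digraph.cycle G c"
  shows "c \<noteq> []" "set c \<subseteq> arcs G" "head G ` set c = tail G ` set c"
proof -
  obtain u where u: "pre_digraph.awalk G u c u" "c \<noteq> []"
    using assms unfolding pre_digraph.cycle_def by blast
  have cas: "pre_digraph.cas G x p y \<Longrightarrow> x # map (head G) p = map (tail G) p @ [y]" for x p y
    by (induction p arbitrary: x) (auto simp: pre_digraph.cas.simps)
  have "u # map (head G) c = map (tail G) c @ [u]" using u(1) by (intro cas) (auto simp: pre_digraph.awalk_def)
  then have "map (head G) c = rotate1 (map (tail G) c)" using u(2) by (cases c) auto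
  then have "set (map (head G) c) = set (map (tail G) c)" by simp
  then show "head G ` set c = tail G ` set c" by simp
  show "c \<noteq> []" "set c \<subseteq> arcs G" using u by (auto simp: pre_digraph.awalk_def)
qed

definition tournament_on :: "'a set \<Rightarrow> ('a \<Rightarrow> 'a \<Rightarrow> bool) \<Rightarrow> bool" where
  "tournament_on V R \<longleftrightarrow> finite V \<and> (\<forall>u\<in>V. \<not> R u u) \<and> (\<forall>u\<in>V. \<forall>v\<in>V. u \<noteq> v \<longrightarrow> R u v = (\<not> R v u))"

lemma tournament_on_arcs_ends:
  assumes "tournament T"
  shows "tournament_on (verts T) (\<lambda>u v. (u, v) \<in> arcs_ends T)"
proof -
  interpret digraph T using assms by (simp add: tournament_def)
  have "(u, v) \<in> arcs_ends T \<longleftrightarrow> (v, u) \<notin> arcs_ends T" if uv: "u \<in> verts T" "v \<in> verts T" "u \<noteq> v" for u v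
  proof -
    have "\<exists>!e. e \<in> arcs T \<and> {tail T e, head T e} = {u, v}"
      using assms uv unfolding tournament_def by simp
    then obtain e where e: "e \<in> arcs T" "{tail T e, head T e} = {u, v}"
      and uniq: "\<And>e'. e' \<in> arcs T \<Longrightarrow> {tail T e', head T e'} = {u, v} \<Longrightarrow> e' = e"
      by blast
    have "(u, v) \<in> arcs_ends T \<or> (v, u) \<in> arcs_ends T"
      using e by (auto simp: arcs_ends_def arc_to_ends_def doubleton_eq_iff image_iff)
    moreover have False if both: "(u, v) \<in> arcs_ends T" "(v, u) \<in> arcs_ends T"
    proof -
      obtain a b where "a \<in> arcs T" "b \<in> arcs T" "tail T a = u" "head T a = v" "tail T b = v" "head T b = u"
        using both by (auto simp: arcs_ends_def arc_to_ends_def)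
      then show False using uniq[of a] uniq[of b] uv(3) by auto
    qed
    ultimately show ?thesis by blast
  qed
  moreover have "(u, u) \<notin> arcs_ends T" for u
    using no_loops by (auto simp: arcs_ends_def arc_to_ends_def)
  ultimately show ?thesis unfolding tournament_on_def using finite_verts by blast
qed

text \<open>
  The bridge from combinatorics to topology: the list \<open>vs\<close> gives the order of the vertices along the moment curve.
\<close>

lemma not_intrinsically_linked_if_untangled:
  assumes T: "tournament T" and vs: "distinct vs" "set vs = verts T"
    and unt: "untangled (length vs) (\<lambda>i j. (vs ! i, vs ! j) \<in> arcs_ends T)"
  shows "\<not> intrinsically_linked_digraph T"
proof
  assume linked: "intrinsically_linked_digraph T"
  interpret digraph T using T by (simp add: tournament_def)
  let ?E = "\<lambda>i j. (vs ! i, vs ! j) \<in> arcs_ends T"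
  define pos where "pos = the_inv_into {..<length vs} (nth vs)"
  have bij: "bij_betw (nth vs) {..<length vs} (verts T)" using vs by (simp add: bij_betw_nth)
  have pos: "pos v < length vs" "vs ! pos v = v" if "v \<in> verts T" for v
    using that the_inv_into_into[of "nth vs" "{..<length vs}" v "{..<length vs}"]
      f_the_inv_into_f_bij_betw[OF bij, of v] bij unfolding pos_def by (auto simp: bij_betw_def)
  have inj: "inj_on pos (verts T)" using pos(2) by (metis inj_onI)
  obtain c d where cd: "cycle c" "cycle d" "cycle_verts T c \<inter> cycle_verts T d = {}"
    "\<not> split_link (cycle_image (moment_arc T pos) c) (cycle_image (moment_arc T pos) d)"
    using linked graph_embedding_moment[OF T inj] tame_moment_embedding[OF finite_verts finite_arcs, of pos]
    unfolding intrinsically_linked_digraph_def by blast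
  define P where "P b = pos ` cycle_verts T b" for b
  have ends: "pos (tail T e) \<in> P b \<and> pos (head T e) \<in> P b" if "cycle b" "e \<in> set b" for b e
    using cycle_arc_lists(3)[OF that(1)] that(2) unfolding P_def cycle_verts_def by blast
  have sub: "cycle_verts T b \<subseteq> verts T" if "cycle b" for b
    using cycle_arc_lists(2)[OF that] tail_in_verts by (auto simp: cycle_verts_def)
  have "?E (pos (tail T e)) (pos (head T e))" if "e \<in> arcs T" for e
    using that pos(2) by (auto simp: arcs_ends_def arc_to_ends_def image_iff intro!: bexI[of _ e])
  then have arc: "?E (pos (tail T e)) (pos (head T e))" if "cycle b" "e \<in> set b" for b e
    using cycle_arc_lists(2)[OF that(1)] that(2) by blast
  have cyc: "cyclic_set ?E (P b)" "P b \<subseteq> {..<length vs}" if b: "cycle b" for b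
  proof -
    show "P b \<subseteq> {..<length vs}" using sub[OF b] pos(1) by (auto simp: P_def)
    show "cyclic_set ?E (P b)" unfolding cyclic_set_def
    proof
      fix v assume "v \<in> P b"
      then obtain e where e: "e \<in> set b" "v = pos (tail T e)" by (auto simp: P_def cycle_verts_def)
      moreover obtain f where "f \<in> set b" "head T f = tail T e"
        using e(1) cycle_arc_lists(3)[OF b] by (metis imageE imageI)
      ultimately show "(\<exists>u\<in>P b. ?E v u) \<and> (\<exists>u\<in>P b. ?E u v)"
        using arc[OF b] ends[OF b] by metis
    qed
  qed
  have disj: "P c \<inter> P d = {}"
    using cd(3) inj_on_image_Int[OF inj sub[OF cd(1)] sub[OF cd(2)]] by (simp add: P_def)
  have split: "split_link (cycle_image (moment_arc T pos) a) (cycle_image (moment_arc T pos) b)"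
    if ab: "cycle a" "cycle b" "P a \<inter> P b = {}"
      "\<And>e. e \<in> set b \<Longrightarrow> \<not> pierces (pos (tail T e), pos (head T e)) (P a)" for a b
  proof (rule split_link_moment_cycles)
    show "a \<noteq> []" "b \<noteq> []" using ab cycle_arc_lists(1) by blast+
    show "pos (tail T e) \<in> P a \<and> pos (head T e) \<in> P a" if "e \<in> set a" for e
      using ends ab(1) that .
    fix e assume e: "e \<in> set b"
    have "pos (tail T e) \<noteq> pos (head T e)"
      using cycle_arc_lists(2)[OF ab(2)] e inj no_loops by (auto simp: inj_on_eq_iff)
    then show "pos (tail T e) \<notin> P a \<and> pos (head T e) \<notin> P a \<and> pos (tail T e) \<noteq> pos (head T e)"
      using ends[OF ab(2) e] ab(3) by blast
    show "\<not> pierces (pos (tail T e), pos (head T e)) (P a)" using ab(4) e .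
  qed
  obtain e where e: "e \<in> set d" "pierces (pos (tail T e), pos (head T e)) (P c)"
    using split[OF cd(1,2) disj] cd(4) by blast
  obtain f where f: "f \<in> set c" "pierces (pos (tail T f), pos (head T f)) (P d)"
    using split[OF cd(2,1)] disj cd(4) split_link_sym by blast
  have "alternate (P c) (P d) \<or> alternate (P d) (P c)"
    using alternate_if_mutually_piercing[OF e(2) _ _ f(2)] ends cd(1,2) e(1) f(1) disj by blast
  then show False using unt cyc cd(1,2) disj unfolding untangled_def by blast
qed

section \<open>Arcs that force an order to be untangled\<close>

text \<open>
  The bounded quantifiers are nested from the largest vertex down, so that for a numeral \<open>n\<close> they unfold to a
  propositional formula in the membership statements.
\<close>

lemma alternate_bounded:
  assumes "A \<subseteq> {..<n}" "B \<subseteq> {..<n}"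
  shows "alternate A B \<longleftrightarrow> (\<exists>f<n. f \<in> B \<and> (\<exists>e<f. e \<in> A \<and> (\<exists>d<e. d \<in> B \<and> (\<exists>c<d. c \<in> A \<and> (\<exists>b<c. b \<in> B \<and> (\<exists>a<b. a \<in> A))))))"
proof
  assume "alternate A B"
  then obtain a b c d e f where *: "a \<in> A" "b \<in> B" "c \<in> A" "d \<in> B" "e \<in> A" "f \<in> B"
    "a < b" "b < c" "c < d" "d < e" "e < f" unfolding alternate_def by blast
  moreover have "f < n" using * assms by auto
  ultimately show "\<exists>f<n. f \<in> B \<and> (\<exists>e<f. e \<in> A \<and> (\<exists>d<e. d \<in> B \<and> (\<exists>c<d. c \<in> A \<and> (\<exists>b<c. b \<in> B \<and> (\<exists>a<b. a \<in> A)))))"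
    by (intro exI conjI)
next
  assume "\<exists>f<n. f \<in> B \<and> (\<exists>e<f. e \<in> A \<and> (\<exists>d<e. d \<in> B \<and> (\<exists>c<d. c \<in> A \<and> (\<exists>b<c. b \<in> B \<and> (\<exists>a<b. a \<in> A)))))"
  then show "alternate A B" unfolding alternate_def by (elim exE conjE) (intro bexI conjI)
qed

lemma ex_less_numeral: "(\<exists>x<numeral k. P x) \<longleftrightarrow> P (pred_numeral k) \<or> (\<exists>x<pred_numeral k. P x)"
  by (auto simp: numeral_eq_Suc less_Suc_eq)

lemma all_less_numeral: "(\<forall>x<numeral k. P x) \<longleftrightarrow> P (pred_numeral k) \<and> (\<forall>x<pred_numeral k. P x)"
  by (auto simp: numeral_eq_Suc less_Suc_eq)

lemma ex_less_1: "(\<exists>x<Suc 0. P x) \<longleftrightarrow> P 0" and all_less_1: "(\<forall>x<Suc 0. P x) \<longleftrightarrow> P 0" by auto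

lemmas bounded_expand = ex_less_numeral ex_less_1 all_less_numeral all_less_1

text \<open>
  It suffices to know that the vertices in \<open>outs\<close> have successors and those in \<open>ins\<close> have predecessors. In the
  applications these are the few vertices whose possible successors or predecessors are known; with bounded quantifiers
  over a numeral \<open>n\<close> the premise unfolds to a small propositional contradiction.
\<close>

lemma untangledI:
  assumes "\<And>A B. \<lbrakk>\<forall>v\<in>set outs. v \<in> A \<longrightarrow> (\<exists>u<n. u \<in> A \<and> E v u); \<forall>v\<in>set ins. v \<in> A \<longrightarrow> (\<exists>u<n. u \<in> A \<and> E u v);
      \<forall>v\<in>set outs. v \<in> B \<longrightarrow> (\<exists>u<n. u \<in> B \<and> E v u); \<forall>v\<in>set ins. v \<in> B \<longrightarrow> (\<exists>u<n. u \<in> B \<and> E u v);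
      \<forall>i<n. i \<notin> A \<or> i \<notin> B;
      \<exists>f<n. f \<in> B \<and> (\<exists>e<f. e \<in> A \<and> (\<exists>d<e. d \<in> B \<and> (\<exists>c<d. c \<in> A \<and> (\<exists>b<c. b \<in> B \<and> (\<exists>a<b. a \<in> A)))))\<rbrakk> \<Longrightarrow> False"
  shows "untangled n E"
  unfolding untangled_def
proof (intro allI impI notI)
  fix A B assume AB: "cyclic_set E A" "cyclic_set E B" "A \<subseteq> {..<n}" "B \<subseteq> {..<n}" "A \<inter> B = {}" "alternate A B"
  have *: "\<forall>v\<in>set outs. v \<in> X \<longrightarrow> (\<exists>u<n. u \<in> X \<and> E v u)" "\<forall>v\<in>set ins. v \<in> X \<longrightarrow> (\<exists>u<n. u \<in> X \<and> E u v)"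
    if "cyclic_set E X" "X \<subseteq> {..<n}" for X
    using that unfolding cyclic_set_def by blast+
  have "\<forall>i<n. i \<notin> A \<or> i \<notin> B" using AB(5) by blast
  then show False
    using AB(6) unfolding alternate_bounded[OF AB(3,4)] by (rule assms[OF *[OF AB(1,3)] *[OF AB(2,4)]])
qed

lemma untangled_if_fewer_cyclic_sets:
  assumes "untangled m E'" and "\<And>A. cyclic_set E A \<Longrightarrow> A \<subseteq> {..<n} \<Longrightarrow> cyclic_set E' A \<and> A \<subseteq> {..<m}"
  shows "untangled n E"
  unfolding untangled_def
proof (intro allI impI)
  fix A B assume AB: "cyclic_set E A" "cyclic_set E B" "A \<subseteq> {..<n}" "B \<subseteq> {..<n}" "A \<inter> B = {}"
  have "cyclic_set E' A" "cyclic_set E' B" "A \<subseteq> {..<m}" "B \<subseteq> {..<m}" using assms(2) AB(1-4) by simp_all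
  then show "\<not> alternate A B" using assms(1) AB(5) unfolding untangled_def by simp
qed

text \<open>
  The largest relation that does not contain the reverse of an arc of \<open>F\<close>. A tournament that contains the arcs
  \<open>F\<close> is a subrelation of it, so a property that is inherited by subrelations has to be checked only for
  \<open>compatible F\<close>, whatever the orientation of the other arcs.
\<close>

definition compatible :: "(nat \<times> nat) list \<Rightarrow> nat \<Rightarrow> nat \<Rightarrow> bool" where
  "compatible F i j \<longleftrightarrow> i \<noteq> j \<and> (j, i) \<notin> set F"

lemma untangled_if_compatible:
  assumes "untangled n (compatible F)" "\<forall>(i, j)\<in>set F. E i j"
    and asym: "\<And>i j. i < n \<Longrightarrow> j < n \<Longrightarrow> E i j \<Longrightarrow> \<not> E j i"
  shows "untangled n E"
proof (rule untangled_if_fewer_cyclic_sets[OF assms(1)])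
  fix A assume A: "cyclic_set E A" "A \<subseteq> {..<n}"
  have "compatible F i j" if "i \<in> A" "j \<in> A" "E i j" for i j
    using that A(2) assms(2) asym unfolding compatible_def by blast
  then have "cyclic_set (compatible F) A" using A(1) unfolding cyclic_set_def by blast
  then show "cyclic_set (compatible F) A \<and> A \<subseteq> {..<n}" using A(2) by simp
qed

lemma untangled_Suc_if_sink:
  assumes "untangled n E" "\<And>i. i \<le> n \<Longrightarrow> \<not> E n i"
  shows "untangled (Suc n) E"
proof (rule untangled_if_fewer_cyclic_sets[OF assms(1)])
  fix A assume A: "cyclic_set E A" "A \<subseteq> {..<Suc n}"
  have "n \<notin> A"
  proof
    assume "n \<in> A"
    then obtain u where u: "u \<in> A" "E n u" using A(1) unfolding cyclic_set_def by blast
    then have "u \<le> n" using A(2) by auto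
    then show False using assms(2) u(2) by blast
  qed
  then show "cyclic_set E A \<and> A \<subseteq> {..<n}" using A by (auto simp: less_Suc_eq)
qed

text \<open>
  Two patterns of arcs on seven positions. In the first one, 3 is a sink of \<open>{1, 3, 5, 6}\<close>, 6 is a sink of
  \<open>{2, 4, 6}\<close> and 5 is a source of \<open>{0, 2, 3, 5}\<close>; in the second one, 1 is a sink of \<open>{1, 3, 5, 6}\<close>, 4 is a
  sink of \<open>{1, 2, 4, 6}\<close> and 6 is a source of \<open>{1, 3, 4, 6}\<close>. A cyclic set that is contained in one of these sets
  cannot contain its sink or source. But if two disjoint sets of positions alternate six times, then one of them
  is contained in one of the three sets and contains the sink or source in question.
\<close>

lemma untangled7_A: "untangled 7 (compatible [(1,3), (2,6), (4,6), (5,0), (5,2), (5,3), (6,3)])"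
  by (rule untangledI[where outs = "[3, 6]" and ins = "[5]"],
      simp (no_asm_use) add: bounded_expand compatible_def del: One_nat_def, argo)

lemma untangled7_B: "untangled 7 (compatible [(1,4), (2,4), (3,1), (5,1), (6,1), (6,3), (6,4)])"
  by (rule untangledI[where outs = "[1, 4]" and ins = "[6]"],
      simp (no_asm_use) add: bounded_expand compatible_def del: One_nat_def, argo)

section \<open>Tournaments on seven vertices\<close>

definition has_untangled_order :: "'a set \<Rightarrow> ('a \<Rightarrow> 'a \<Rightarrow> bool) \<Rightarrow> bool" where
  "has_untangled_order V R \<longleftrightarrow> (\<exists>vs. distinct vs \<and> set vs = V \<and> untangled (length vs) (\<lambda>i j. R (vs ! i) (vs ! j)))"

lemma tournament_on_converse: "tournament_on V R\<inverse>\<inverse> \<longleftrightarrow> tournament_on V R"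
  unfolding tournament_on_def by auto

lemma has_untangled_order_converse: "has_untangled_order V R\<inverse>\<inverse> \<longleftrightarrow> has_untangled_order V R"
proof -
  have "untangled n (\<lambda>i j. R\<inverse>\<inverse> (f i) (f j)) \<longleftrightarrow> untangled n (\<lambda>i j. R (f i) (f j))" for n and f :: "nat \<Rightarrow> 'a"
    using untangled_converse[of n "\<lambda>i j. R (f i) (f j)"] by simp
  then show ?thesis by (simp add: has_untangled_order_def)
qed

lemma tournament_on_asym:
  assumes "tournament_on V R" "u \<in> V" "v \<in> V" "R u v"
  shows "\<not> R v u" "u \<noteq> v"
  using assms unfolding tournament_on_def by metis+

lemma tournament_on_subset: "tournament_on V R \<Longrightarrow> U \<subseteq> V \<Longrightarrow> tournament_on U R"
  unfolding tournament_on_def by (meson finite_subset subsetD)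

lemma has_untangled_orderI:
  assumes "tournament_on V R" "distinct vs" "set vs = V" "length vs = n"
    and "untangled n (compatible F)" "\<forall>(i, j)\<in>set F. R (vs ! i) (vs ! j)"
  shows "has_untangled_order V R"
  unfolding has_untangled_order_def
proof (intro exI conjI)
  show "untangled (length vs) (\<lambda>i j. R (vs ! i) (vs ! j))" unfolding \<open>length vs = n\<close>
  proof (rule untangled_if_compatible[OF assms(5,6)])
    fix i j assume "i < n" "j < n" "R (vs ! i) (vs ! j)"
    then show "\<not> R (vs ! j) (vs ! i)" using tournament_on_asym(1)[OF assms(1)] assms(3,4) nth_mem by metis
  qed
qed (use assms in auto)

text \<open>
  A sink lies in no cyclic set, so it may be appended at the end of the order.
\<close>

lemma has_untangled_order_add_sink:
  assumes "has_untangled_order (V - {v}) R" "v \<in> V" "\<And>w. w \<in> V \<Longrightarrow> \<not> R v w"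
  shows "has_untangled_order V R"
proof -
  obtain vs where vs: "distinct vs" "set vs = V - {v}" "untangled (length vs) (\<lambda>i j. R (vs ! i) (vs ! j))"
    using assms(1) unfolding has_untangled_order_def by (elim exE conjE)
  have set_vs: "set (vs @ [v]) = V" using vs(2) assms(2) by auto
  have "untangled (Suc (length vs)) (\<lambda>i j. R ((vs @ [v]) ! i) ((vs @ [v]) ! j))"
  proof (rule untangled_Suc_if_sink)
    show "untangled (length vs) (\<lambda>i j. R ((vs @ [v]) ! i) ((vs @ [v]) ! j))"
    proof (rule untangled_if_fewer_cyclic_sets[OF vs(3)])
      fix A assume A: "cyclic_set (\<lambda>i j. R ((vs @ [v]) ! i) ((vs @ [v]) ! j)) A" "A \<subseteq> {..<length vs}"
      have nth: "(vs @ [v]) ! i = vs ! i" if "i \<in> A" for i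
        using that A(2) by (intro nth_append_left) auto
      have "cyclic_set (\<lambda>i j. R (vs ! i) (vs ! j)) A"
        unfolding cyclic_set_def
      proof
        fix i assume i: "i \<in> A"
        show "(\<exists>u\<in>A. R (vs ! i) (vs ! u)) \<and> (\<exists>u\<in>A. R (vs ! u) (vs ! i))"
          using bspec[OF A(1)[unfolded cyclic_set_def] i] nth i by (metis (no_types, lifting))
      qed
      then show "cyclic_set (\<lambda>i j. R (vs ! i) (vs ! j)) A \<and> A \<subseteq> {..<length vs}"
        using A(2) by (intro conjI)
    qed
  next
    fix i assume "i \<le> length vs"
    then have "(vs @ [v]) ! i \<in> set (vs @ [v])" by (intro nth_mem) simp
    then have "(vs @ [v]) ! i \<in> V" unfolding set_vs .
    then show "\<not> R ((vs @ [v]) ! length vs) ((vs @ [v]) ! i)" using assms(3) by simp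
  qed
  moreover have "distinct (vs @ [v])" using vs(1,2) by simp
  ultimately show ?thesis using set_vs
    unfolding has_untangled_order_def by (intro exI[of _ "vs @ [v]"] conjI) simp_all
qed

lemma tournament_path3:
  assumes "tournament_on X R" "card X = 3"
  obtains a b c where "X = {a, b, c}" "distinct [a, b, c]" "R a b" "R b c"
proof -
  obtain x y z where X: "X = {x, y, z}" "x \<noteq> y" "y \<noteq> z" "x \<noteq> z" using assms(2) by (metis card_3_iff)
  have t: "R u v \<or> R v u" if "u \<in> X" "v \<in> X" "u \<noteq> v" for u v
    using assms(1) that unfolding tournament_on_def by blast
  have xy: "R x y \<or> R y x" and yz: "R y z \<or> R z y" and xz: "R x z \<or> R z x"
    using t X by auto
  note found = that
  have p: thesis if "{a, b, c} = X" "distinct [a, b, c]" "R a b" "R b c" for a b c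
    using found[of a b c] that by simp
  show thesis using xy yz xz p[of x y z] p[of x z y] p[of y x z] p[of y z x] p[of z x y] p[of z y x] X by auto
qed

lemma tournament_transitive_triple:
  assumes "tournament_on X R" "card X \<ge> 4"
  obtains p q r where "{p, q, r} \<subseteq> X" "distinct [p, q, r]" "R p q" "R q r" "R p r"
proof -
  have t: "R u v \<or> R v u" if "u \<in> X" "v \<in> X" "u \<noteq> v" for u v
    using assms(1) that unfolding tournament_on_def by blast
  obtain Y where "Y \<subseteq> X" "card Y = 4" using assms(2) by (meson obtain_subset_with_card_n)
  then obtain xs where xs: "distinct xs" "set xs \<subseteq> X" "length xs = 4"
    by (metis card.infinite distinct_card finite_distinct_list zero_neq_numeral)
  then obtain x y z w where "xs = [x, y, z, w]" by (auto simp: numeral_eq_Suc length_Suc_conv)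
  then have X: "{x, y, z, w} \<subseteq> X" "distinct [x, y, z, w]" using xs by auto
  note found = that
  have p: thesis if "R a b \<and> R b c \<and> R a c" "{a, b, c} \<subseteq> {x, y, z, w}" "distinct [a, b, c]" for a b c
    using found[of a b c] that X by blast
  \<comment> \<open>Two of the three arcs at \<open>x\<close> agree in direction; the arc between their other ends completes the triple.\<close>
  have out: thesis if "R x a" "R x b" "a \<noteq> b" "{a, b} \<subseteq> {y, z, w}" for a b
    using t[of a b] that X p[of x a b] p[of x b a] by auto
  have into: thesis if "R a x" "R b x" "a \<noteq> b" "{a, b} \<subseteq> {y, z, w}" for a b
    using t[of a b] that X p[of a b x] p[of b a x] by auto
  show thesis using t[of x y] t[of x z] t[of x w] X out[of y z] out[of y w] out[of z w] into[of y z] into[of y w] into[of z w] by auto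
qed

text \<open>
  Three out-neighbours of \<open>x\<close> contain a path \<open>a, b, c\<close>, and the other three vertices form a path \<open>d, e, f\<close>. This
  fixes seven arcs. If there is no good order, then none of the two patterns occurs on the seven vertices, and the
  23 placements of the patterns below already exclude all orientations of the remaining 14 arcs.
\<close>

lemma has_untangled_order_if_out_degree_ge_3:
  assumes tour: "tournament_on W R" and "card W = 7" "x \<in> W" "3 \<le> card {w \<in> W. R x w}"
  shows "has_untangled_order W R"
proof (rule ccontr)
  assume no: "\<not> has_untangled_order W R"
  have fin: "finite W" using tour by (simp add: tournament_on_def)
  obtain X where X: "X \<subseteq> {w \<in> W. R x w}" "card X = 3" using assms(4) by (meson obtain_subset_with_card_n)
  then obtain a b c where abc: "X = {a, b, c}" "distinct [a, b, c]" "R a b" "R b c"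
    using tournament_path3[OF tournament_on_subset[OF tour]] by (metis (no_types, lifting) mem_Collect_eq subset_iff)
  have xabc: "x \<notin> {a, b, c}" "{a, b, c} \<subseteq> W" "R x a" "R x b" "R x c"
    using X abc(1) tournament_on_asym(2)[OF tour] by auto
  define Y where "Y = W - {x, a, b, c}"
  have "card Y = 3" unfolding Y_def using xabc abc(2) assms(2,3) fin by (subst card_Diff_subset) auto
  moreover have "tournament_on Y R" using tournament_on_subset[OF tour] unfolding Y_def by simp
  ultimately obtain d e f where def: "Y = {d, e, f}" "distinct [d, e, f]" "R d e" "R e f"
    using tournament_path3 by blast
  have "W = {x, a, b, c} \<union> {d, e, f}" using xabc(2) assms(3) unfolding def(1)[symmetric] Y_def by blast
  then have W: "W = {x, a, b, c, d, e, f}" by (simp add: insert_commute)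
  have dist: "distinct [x, a, b, c, d, e, f]" using abc(2) def(1,2) xabc(1) unfolding Y_def by auto
  note arcs = abc(3,4) def(3,4) xabc(3-5)
  have pat: False if "untangled 7 (compatible P)" "{v0, v1, v2, v3, v4, v5, v6} = W" "distinct [v0, v1, v2, v3, v4, v5, v6]"
    "\<forall>(i, j)\<in>set P. R ([v0, v1, v2, v3, v4, v5, v6] ! i) ([v0, v1, v2, v3, v4, v5, v6] ! j)" for P v0 v1 v2 v3 v4 v5 v6
    using has_untangled_orderI[OF tour that(3) _ _ that(1,4)] that(2) no by simp
  have patA: False if "{v0, v1, v2, v3, v4, v5, v6} = W" "distinct [v0, v1, v2, v3, v4, v5, v6]"
    "R v1 v3" "R v2 v6" "R v4 v6" "R v5 v0" "R v5 v2" "R v5 v3" "R v6 v3" for v0 v1 v2 v3 v4 v5 v6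
    by (rule pat[OF untangled7_A that(1,2)]) (use that(3-) in simp)
  have patB: False if "{v0, v1, v2, v3, v4, v5, v6} = W" "distinct [v0, v1, v2, v3, v4, v5, v6]"
    "R v1 v4" "R v2 v4" "R v3 v1" "R v5 v1" "R v6 v1" "R v6 v3" "R v6 v4" for v0 v1 v2 v3 v4 v5 v6
    by (rule pat[OF untangled7_B that(1,2)]) (use that(3-) in simp)
  \<comment> \<open>Each formula lists the arcs of one placement of a pattern that are not among the seven fixed ones.\<close>
  have c1: "\<not> (R x f \<and> R b f \<and> R c e)"
    using patA[of a b c f d x e] arcs W dist by auto
  have c2: "\<not> (R e a \<and> R f a \<and> R b e)"
    using patA[of c f b a d x e] arcs W dist by auto
  have c3: "\<not> (R a d \<and> R a f \<and> R c f)"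
    using patA[of d e b f x a c] arcs W dist by auto
  have c4: "\<not> (R d a \<and> R f a \<and> R c f)"
    using patA[of b d c a e x f] arcs W dist by auto
  have c5: "\<not> (R a f \<and> R b d \<and> R b e \<and> R f c)"
    using patA[of d x e c a b f] arcs W dist by auto
  have c6: "\<not> (R a e \<and> R b d \<and> R b f \<and> R e c)"
    using patA[of f x d c a b e] arcs W dist by auto
  have c7: "\<not> (R e b \<and> R f b \<and> R c e)"
    using patA[of a f c b d x e] arcs W dist by auto
  have c8: "\<not> (R c a \<and> R b e \<and> R c e \<and> R c f)"
    using patA[of f d a e x c b] arcs W dist by auto
  have c9: "\<not> (R d a \<and> R a f \<and> R b d \<and> R b f)"
    using patA[of c e d f x b a] arcs W dist by auto
  have c10: "\<not> (R c a \<and> R x e \<and> R a e \<and> R f a)"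
    using patA[of b d c e f x a] arcs W dist by auto
  have c11: "\<not> (R a e \<and> R f a \<and> R b e \<and> R b f)"
    using patA[of c d f e x b a] arcs W dist by auto
  have c12: "\<not> (R c a \<and> R f d \<and> R b d \<and> R c d \<and> R c e)"
    using patA[of e f a d x c b] arcs W dist by auto
  have c13: "\<not> (R d f \<and> R x d \<and> R f c)"
    using patA[of a b d c e x f] arcs W dist by auto
  have c14: "\<not> (R d f \<and> R d x \<and> R b e \<and> R c e)"
    using patA[of f c x e a d b] arcs W dist by auto
  have c15: "\<not> (R f b \<and> R d c)"
    using patB[of e b d a c f x] arcs W dist by auto
  have c16: "\<not> (R e b \<and> R f c)"
    using patB[of d b f a c e x] arcs W dist by auto
  have c17: "\<not> (R d b \<and> R e c)"
    using patB[of f b e a c d x] arcs W dist by auto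
  have c18: "\<not> (R a c \<and> R a e \<and> R c e)"
    using patB[of f c d b e x a] arcs W dist by auto
  have c19: "\<not> (R f b \<and> R e c)"
    using patB[of d b e a c f x] arcs W dist by auto
  have c20: "\<not> (R d b \<and> R f c)"
    using patB[of e b f a c d x] arcs W dist by auto
  have c21: "\<not> (R e a \<and> R e b \<and> R b f \<and> R c f)"
    using patB[of d b c a f x e] arcs W dist by auto
  have c22: "\<not> (R a c \<and> R a f \<and> R c f)"
    using patB[of d c e b f x a] arcs W dist by auto
  have c23: "\<not> (R c a \<and> R a e \<and> R b f \<and> R c e \<and> R c f)"
    using patB[of x e b a f d c] arcs W dist by auto
  have total: "R u v \<longleftrightarrow> \<not> R v u" if "u \<in> W" "v \<in> W" "u \<noteq> v" for u v
    using tour that unfolding tournament_on_def by blast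
  have t: "R c a \<longleftrightarrow> \<not> R a c" "R f d \<longleftrightarrow> \<not> R d f" "R d x \<longleftrightarrow> \<not> R x d" "R e x \<longleftrightarrow> \<not> R x e" "R f x \<longleftrightarrow> \<not> R x f"
    "R d a \<longleftrightarrow> \<not> R a d" "R e a \<longleftrightarrow> \<not> R a e" "R f a \<longleftrightarrow> \<not> R a f"
    "R d b \<longleftrightarrow> \<not> R b d" "R e b \<longleftrightarrow> \<not> R b e" "R f b \<longleftrightarrow> \<not> R b f"
    "R d c \<longleftrightarrow> \<not> R c d" "R e c \<longleftrightarrow> \<not> R c e" "R f c \<longleftrightarrow> \<not> R c f"
    by (rule total; use dist in \<open>auto simp: W\<close>)+
  show False using c1 c2 c3 c4 c5 c6 c7 c8 c9 c10 c11 c12 c13 c14 c15 c16 c17 c18 c19 c20 c21 c22 c23 unfolding t by argo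
qed

section \<open>Vertices of out-degree or in-degree one\<close>

text \<open>
  Vertices 0, 1, 2 form a path that contains the only arcs out of 0 and out of 1, so a cyclic set that meets
  \<open>{0, 1, 2}\<close> contains 2, and only one of two disjoint cyclic sets can do so. Alternating six times along the six
  blocks \<open>{0, 1, 2}\<close>, 3, 4, 5, 6, 7 would make the other set equal to \<open>{3, 5, 7}\<close>, which has the source 3.
\<close>

lemma untangled8_chain:
  "untangled 8 (compatible
    [(0,1), (1,2), (2,0), (3,0), (3,1), (3,5), (3,7), (4,0), (4,1), (5,0), (5,1), (5,7),
     (6,0), (6,1), (7,0), (7,1)])"
  by (rule untangledI[where outs = "[0, 1]" and ins = "[3]"],
      simp (no_asm_use) add: bounded_expand compatible_def del: One_nat_def, argo)

text \<open>
  The only arc out of 0 goes to 1, and the only arc into 4 comes from 3. A cyclic set that meets \<open>{0, 1}\<close> contains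
  1, and one that meets \<open>{3, 4}\<close> contains 3. Again there are six blocks, and one of the alternating sets would
  be \<open>{2, 5, 7}\<close>, which has the source 2.
\<close>

lemma untangled8_disjoint:
  "untangled 8 (compatible
    [(0,1), (2,0), (2,5), (2,7), (3,0), (3,4), (4,0), (4,1), (4,2), (4,5), (4,6), (4,7),
     (5,0), (5,7), (6,0), (7,0)])"
  by (rule untangledI[where outs = "[0]" and ins = "[2, 4]"],
      simp (no_asm_use) add: bounded_expand compatible_def del: One_nat_def, argo)

text \<open>
  The only arc out of 0 goes to 1, and the only arc into 2 comes from 1. So a cyclic set that meets \<open>{0, 1, 2}\<close>
  contains 1, and the blocks are the same as for \<open>untangled8_chain\<close>.
\<close>

lemma untangled8_through:
  "untangled 8 (compatible
    [(0,1), (1,2), (2,0), (2,3), (2,4), (2,5), (2,6), (2,7), (3,0), (3,5), (3,7), (4,0),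
     (5,0), (5,7), (6,0), (7,0)])"
  by (rule untangledI[where outs = "[0]" and ins = "[2, 3]"],
      simp (no_asm_use) add: bounded_expand compatible_def del: One_nat_def, argo)

text \<open>
  The arc from 3 to 4 is the only one out of 3 and the only one into 4, so 3 and 4 lie in the same cyclic sets. The
  other arcs into 1 and 2, apart from those coming from 4, are the one from 0 to 1 and the one from 1 to 2. So
  a cyclic set without 4 that contains 2 also contains 1, and one that contains 1 also contains 0: it
  meets \<open>{0, 1, 2}\<close> in an initial segment. What is left of \<open>{0, 1, 2}\<close> can only belong to the set through 3 and 4,
  which come next. Hence two disjoint cyclic sets form at most two runs on the positions 0 to 4 and at most five
  runs altogether.
\<close>

lemma untangled8_shared:
  "untangled 8 (compatible
    [(0,1), (0,3), (1,2), (1,3), (1,5), (1,6), (1,7), (2,0), (2,3), (2,5), (2,6), (2,7),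
     (3,4), (4,0), (4,1), (4,2), (4,5), (4,6), (4,7), (5,3), (6,3), (7,3)])"
  by (rule untangledI[where outs = "[3]" and ins = "[1, 2, 4]"],
      simp (no_asm_use) add: bounded_expand compatible_def del: One_nat_def, argo)

lemma card_in_out:
  assumes "tournament_on V R" "v \<in> V"
  shows "card {w \<in> V. R v w} + card {w \<in> V. R w v} + 1 = card V"
proof -
  define A B where "A = {w \<in> V. R v w}" and "B = {w \<in> V. R w v}"
  have fin: "finite A" "finite B" using assms by (simp_all add: tournament_on_def A_def B_def)
  have tot: "R v w = (\<not> R w v)" if "w \<in> V" "w \<noteq> v" for w
    using assms that unfolding tournament_on_def by metis
  have "\<not> R v v" using assms unfolding tournament_on_def by blast
  then have "V = insert v (A \<union> B)" "A \<inter> B = {}" "v \<notin> A \<union> B"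
    using assms(2) tot unfolding A_def B_def by auto
  then have "card V = Suc (card A + card B)"
    using fin by (simp add: card_Un_disjoint)
  then show ?thesis by (simp add: A_def B_def)
qed

text \<open>
  A vertex has out-degree or in-degree at least three; reverse the arcs in the second case.
\<close>

lemma has_untangled_order_of_7:
  assumes "tournament_on W R" "card W = 7"
  shows "has_untangled_order W R"
proof -
  have "W \<noteq> {}" using assms(2) by auto
  then obtain x where x: "x \<in> W" by blast
  have "card {w \<in> W. R x w} + card {w \<in> W. R w x} + 1 = 7" using card_in_out[OF assms(1) x] assms(2) by simp
  then consider "3 \<le> card {w \<in> W. R x w}" | "3 \<le> card {w \<in> W. R w x}" by linarith
  then show ?thesis
  proof cases
    case 1
    show ?thesis by (rule has_untangled_order_if_out_degree_ge_3[OF assms x 1])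
  next
    case 2
    have "has_untangled_order W R\<inverse>\<inverse>"
    proof (rule has_untangled_order_if_out_degree_ge_3)
      show "tournament_on W R\<inverse>\<inverse>" unfolding tournament_on_converse by fact
      show "3 \<le> card {w \<in> W. R\<inverse>\<inverse> x w}" using 2 by simp
    qed (use assms x in auto)
    then show ?thesis by (simp add: has_untangled_order_converse)
  qed
qed

lemma has_untangled_order_sink:
  assumes "tournament_on V R" "card V = 8" "v \<in> V" "card {w \<in> V. R v w} = 0"
  shows "has_untangled_order V R"
proof (rule has_untangled_order_add_sink)
  have fin: "finite V" using assms(1) by (simp add: tournament_on_def)
  have "card (V - {v}) = 7" using assms(2,3) by simp
  then show "has_untangled_order (V - {v}) R"
    using has_untangled_order_of_7 tournament_on_subset[OF assms(1)] by blast
  show "\<not> R v w" if "w \<in> V" for w using assms(4) fin that by auto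
qed (fact assms(3))

lemma unique_out_neighbourE:
  assumes tour: "tournament_on V R" and v: "v \<in> V" "card {w \<in> V. R v w} = 1"
  obtains w where "w \<in> V" "R v w" "\<And>x. x \<in> V \<Longrightarrow> x \<noteq> v \<Longrightarrow> x \<noteq> w \<Longrightarrow> R x v"
proof -
  obtain w where "{w \<in> V. R v w} = {w}" using v(2) by (rule card_1_singletonE)
  then have w: "w \<in> V" "R v w" "\<And>x. x \<in> V \<Longrightarrow> R v x \<Longrightarrow> x = w" by auto
  have "R x v" if "x \<in> V" "x \<noteq> v" "x \<noteq> w" for x
    using tour v(1) that w(3)[of x] unfolding tournament_on_def by blast
  then show thesis using that w by blast
qed

lemma unique_in_neighbourE:
  assumes tour: "tournament_on V R" and v: "v \<in> V" "card {w \<in> V. R w v} = 1"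
  obtains w where "w \<in> V" "R w v" "\<And>x. x \<in> V \<Longrightarrow> x \<noteq> v \<Longrightarrow> x \<noteq> w \<Longrightarrow> R v x"
  using unique_out_neighbourE[of V "R\<inverse>\<inverse>" v] assms by (auto simp: tournament_on_converse)

lemma transitive_triple_of_5:
  assumes "tournament_on X R" "card X = 5"
  obtains p q r m n where "X = {p, q, r, m, n}" "distinct [p, q, r, m, n]" "R p q" "R q r" "R p r"
proof -
  obtain p q r where pqr: "{p, q, r} \<subseteq> X" "distinct [p, q, r]" "R p q" "R q r" "R p r"
    using tournament_transitive_triple[OF assms(1)] assms(2) by auto
  have "card (X - {p, q, r}) = 2"
    using pqr(1,2) assms by (subst card_Diff_subset) auto
  then obtain m n where "X - {p, q, r} = {m, n}" "m \<noteq> n" by (auto simp: card_2_iff)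
  then show thesis using pqr by (intro that[of p q r m n]) auto
qed

text \<open>
  The arc between the two vertices is the only arc out of one of them, so that they start a path of three vertices
  as in \<open>untangled8_chain\<close>. The other five vertices contain a transitive triple, which is placed on every other
  position.
\<close>

lemma has_untangled_order_two_out_degree_1:
  assumes tour: "tournament_on V R" "card V = 8" and "u \<in> V" "v \<in> V" "u \<noteq> v"
    and "card {w \<in> V. R u w} = 1" "card {w \<in> V. R v w} = 1"
  shows "has_untangled_order V R"
proof -
  have chain: "has_untangled_order V R"
    if ab: "a \<in> V" "b \<in> V" "R a b" "card {w \<in> V. R a w} = 1" "card {w \<in> V. R b w} = 1" for a b
  proof -
    have "a \<noteq> b" using tournament_on_asym(2)[OF tour(1) ab(1-3)] .
    obtain b' where b': "\<And>x. x \<in> V \<Longrightarrow> x \<noteq> a \<Longrightarrow> x \<noteq> b' \<Longrightarrow> R x a"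
      using unique_out_neighbourE[OF tour(1) ab(1,4)] by metis
    have "\<not> R b a" using tournament_on_asym(1)[OF tour(1) ab(1-3)] .
    then have "b' = b" using b' ab(2) \<open>a \<noteq> b\<close> by metis
    then have into_a: "R x a" if "x \<in> V" "x \<noteq> a" "x \<noteq> b" for x using b' that by simp
    obtain w where w: "w \<in> V" "R b w" "\<And>x. x \<in> V \<Longrightarrow> x \<noteq> b \<Longrightarrow> x \<noteq> w \<Longrightarrow> R x b"
      using unique_out_neighbourE[OF tour(1) ab(2,5)] by blast
    have "w \<noteq> b" "w \<noteq> a" using tournament_on_asym[OF tour(1)] ab w(1,2) by blast+
    define X where "X = V - {a, b, w}"
    have "card X = 5" unfolding X_def
      using \<open>a \<noteq> b\<close> \<open>w \<noteq> b\<close> \<open>w \<noteq> a\<close> ab(1,2) w(1) tour by (subst card_Diff_subset) auto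
    have "tournament_on X R" using tournament_on_subset[OF tour(1)] by (auto simp: X_def)
    obtain p q r m n where X: "X = {p, q, r, m, n}" "distinct [p, q, r, m, n]" "R p q" "R q r" "R p r"
      by (rule transitive_triple_of_5[OF \<open>tournament_on X R\<close> \<open>card X = 5\<close>])
    have inX: "x \<in> V \<and> x \<notin> {a, b, w}" if "x \<in> {p, q, r, m, n}" for x using that X(1) X_def by blast
    have "V = {a, b, w} \<union> {p, q, r, m, n}" using ab(1,2) w(1) unfolding X(1)[symmetric] X_def by blast
    then have V: "{a, b, w, p, m, q, n, r} = V" by (simp add: insert_commute)
    have dist: "distinct [a, b, w, p, m, q, n, r]"
      using X(2) inX \<open>a \<noteq> b\<close> \<open>w \<noteq> b\<close> \<open>w \<noteq> a\<close> by auto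
    have "R x a" if "x \<in> {w, p, m, q, n, r}" for x
      using into_a[of x] inX[of x] that w(1) \<open>w \<noteq> b\<close> \<open>w \<noteq> a\<close> by blast
    moreover have "R x b" if "x \<in> {p, m, q, n, r}" for x
      using w(3)[of x] inX[of x] that by blast
    ultimately show ?thesis
      by (intro has_untangled_orderI[OF tour(1) dist _ _ untangled8_chain])
        (use V ab(3) w(2) X(3-5) in simp_all)
  qed
  show ?thesis using chain[of u v] chain[of v u] assms unfolding tournament_on_def by blast
qed

text \<open>
  Say \<open>R a b\<close>. Then \<open>u\<close> and \<open>a\<close> are the two in-neighbours of \<open>b\<close>, and the in-neighbours of \<open>a\<close> are \<open>u\<close> and
  some \<open>c\<close>. This leaves three vertices whose mutual arcs are arbitrary.
\<close>

lemma has_untangled_order_shared_arc: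
  assumes tour: "tournament_on V R" "card V = 8" and vu: "v \<in> V" "u \<in> V" "R v u"
    and into_v: "\<And>x. x \<in> V \<Longrightarrow> x \<noteq> v \<Longrightarrow> x \<noteq> u \<Longrightarrow> R x v"
    and from_u: "\<And>x. x \<in> V \<Longrightarrow> x \<noteq> v \<Longrightarrow> x \<noteq> u \<Longrightarrow> R u x"
    and ab: "a \<in> V" "b \<in> V" "a \<noteq> b" "{a, b} \<inter> {u, v} = {}" "card {w \<in> V. R w a} = 2" "card {w \<in> V. R w b} = 2"
  shows "has_untangled_order V R"
proof -
  have fin: "finite V" using tour(1) by (simp add: tournament_on_def)
  have uv: "v \<noteq> u" using tournament_on_asym(2)[OF tour(1) vu] .
  have order: "has_untangled_order V R"
    if ab: "a \<in> V" "b \<in> V" "{a, b} \<inter> {u, v} = {}" "card {w \<in> V. R w a} = 2" "card {w \<in> V. R w b} = 2" "R a b" for a b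
  proof -
    have ne: "a \<noteq> b" "a \<noteq> u" "a \<noteq> v" "b \<noteq> u" "b \<noteq> v" using tournament_on_asym(2)[OF tour(1) ab(1,2,6)] ab(3) by auto
    have ua: "R u a" and ub: "R u b" and av: "R a v" using from_u into_v ab ne by auto
    have "{u, a} \<subseteq> {w \<in> V. R w b}" using ub ab vu by auto
    then have in_b: "{w \<in> V. R w b} = {u, a}"
      using ab(5) ne fin by (intro card_seteq[symmetric]) auto
    have "u \<in> {w \<in> V. R w a}" using ua vu by auto
    moreover obtain x y where "{w \<in> V. R w a} = {x, y}" "x \<noteq> y"
      using ab(4) unfolding card_2_iff by blast
    ultimately obtain c where c: "{w \<in> V. R w a} = {u, c}" "c \<noteq> u"
      by (metis insertE insert_commute singletonD)
    then have cV: "c \<in> V" and ca: "R c a" by auto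
    have nc: "c \<noteq> a" "c \<noteq> b" "c \<noteq> v"
      using tournament_on_asym[OF tour(1)] ca cV ab(1,2,6) av vu(1) by blast+
    have tot: "R y x" if "\<not> R x y" "x \<noteq> y" "x \<in> V" "y \<in> V" for x y
      using tour(1) that unfolding tournament_on_def by blast
    have from_a: "R a x" if "x \<in> V" "x \<noteq> a" "x \<noteq> u" "x \<noteq> c" for x
      using tot[of x a] that c(1) ab(1) by blast
    have from_b: "R b x" if "x \<in> V" "x \<noteq> b" "x \<noteq> u" "x \<noteq> a" for x
      using tot[of x b] that in_b ab(2) by blast
    have "card (V - {c, a, b, v, u}) = 3"
      using tour(2) ne nc c(2) uv cV ab(1,2) vu(1,2) by (subst card_Diff_subset) auto
    then obtain d e f where def: "V - {c, a, b, v, u} = {d, e, f}" "distinct [d, e, f]"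
      by (auto simp: card_3_iff)
    have "V = {c, a, b, v, u} \<union> {d, e, f}" using cV ab(1,2) vu(1,2) unfolding def(1)[symmetric] by blast
    then have V: "set [c, a, b, v, u, d, e, f] = V" by (simp add: insert_commute)
    have out: "x \<in> V \<and> x \<notin> {c, a, b, v, u}" if "x \<in> {d, e, f}" for x using that def(1) by blast
    have dist: "distinct [c, a, b, v, u, d, e, f]"
      using def(2) out ne nc c(2) uv by auto
    have "R x v \<and> R u x" if "x \<in> {c, a, b, d, e, f}" for x
      using into_v[of x] from_u[of x] that out[of x] ab(1,2) cV ne nc c(2) by blast
    moreover have "R a x \<and> R b x" if "x \<in> {d, e, f}" for x
      using from_a[of x] from_b[of x] that out[of x] by blast
    moreover have "R b c" using from_b[OF cV] nc c(2) by blast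
    ultimately show ?thesis
      by (intro has_untangled_orderI[OF tour(1) dist V _ untangled8_shared]) (use ca ab(6) vu in simp_all)
  qed
  show ?thesis
  proof (cases "R a b")
    case True
    then show ?thesis using order ab by blast
  next
    case False
    then have "R b a" using tour(1) ab(1-3) unfolding tournament_on_def by blast
    then show ?thesis using order[of b a] ab by blast
  qed
qed

text \<open>
  Here the arc out of \<open>v\<close> goes to some \<open>w\<close> and the arc into \<open>u\<close> comes from some \<open>t\<close>, and neither of the two arcs joins
  \<open>v\<close> and \<open>u\<close>. Either \<open>w = t\<close> and the arcs form a path, or they are disjoint.
\<close>

lemma has_untangled_order_out1_in1:
  assumes tour: "tournament_on V R" "card V = 8" and "v \<in> V" "u \<in> V" "u \<noteq> v"
    and "card {w \<in> V. R v w} = 1" "card {w \<in> V. R w u} = 1" "\<not> R v u"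
  shows "has_untangled_order V R"
proof -
  obtain w where w: "w \<in> V" "R v w" "\<And>x. x \<in> V \<Longrightarrow> x \<noteq> v \<Longrightarrow> x \<noteq> w \<Longrightarrow> R x v"
    using unique_out_neighbourE[OF tour(1) assms(3,6)] by blast
  obtain t where t: "t \<in> V" "R t u" "\<And>x. x \<in> V \<Longrightarrow> x \<noteq> u \<Longrightarrow> x \<noteq> t \<Longrightarrow> R u x"
    using unique_in_neighbourE[OF tour(1) assms(4,7)] by blast
  have ne: "v \<noteq> w" "t \<noteq> u" "w \<noteq> u" "t \<noteq> v" "u \<noteq> v"
    using tournament_on_asym(2)[OF tour(1)] assms w t by blast+
  show ?thesis
  proof (cases "w = t")
    case True
    have "card (V - {v, w, u}) = 5"
      using tour(2) ne w(1) assms(3,4) by (subst card_Diff_subset) auto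
    then obtain p q r m n where X: "V - {v, w, u} = {p, q, r, m, n}" "distinct [p, q, r, m, n]" "R p q" "R q r" "R p r"
      by (rule transitive_triple_of_5[OF tournament_on_subset[OF tour(1) Diff_subset]])
    have "V = {v, w, u} \<union> {p, q, r, m, n}" using w(1) assms(3,4) unfolding X(1)[symmetric] by blast
    then have V: "set [v, w, u, p, m, q, n, r] = V" by (simp add: insert_commute)
    have out: "x \<in> V \<and> x \<notin> {v, w, u}" if "x \<in> {p, q, r, m, n}" for x using that X(1) by blast
    have dist: "distinct [v, w, u, p, m, q, n, r]" using X(2) out ne by auto
    have "R x v" if "x \<in> {u, p, m, q, n, r}" for x
      using w(3)[of x] that out[of x] assms(4) ne by blast
    moreover have "R u x" if "x \<in> {v, p, m, q, n, r}" for x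
      using t(3)[of x] that out[of x] assms(3) ne True by blast
    ultimately show ?thesis
      by (intro has_untangled_orderI[OF tour(1) dist V _ untangled8_through])
        (use X(3-5) True w(2) t(2) in simp_all)
  next
    case False
    have "card (V - {v, w, t, u}) = 4"
      using tour(2) ne False w(1) t(1) assms(3,4) by (subst card_Diff_subset) auto
    moreover have tourX: "tournament_on (V - {v, w, t, u}) R" using tournament_on_subset[OF tour(1)] by simp
    ultimately obtain p q r where X: "{p, q, r} \<subseteq> V - {v, w, t, u}" "distinct [p, q, r]" "R p q" "R q r" "R p r"
      using tournament_transitive_triple by (metis order_refl)
    have "card (V - {v, w, t, u} - {p, q, r}) = 1"
      using \<open>card (V - {v, w, t, u}) = 4\<close> X(1,2) by (subst card_Diff_subset) auto
    then obtain m where m: "V - {v, w, t, u} - {p, q, r} = {m}" by (rule card_1_singletonE)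
    have "V = {v, w, t, u} \<union> ({p, q, r} \<union> {m})"
      using X(1) w(1) t(1) assms(3,4) unfolding m[symmetric] by blast
    then have V: "set [v, w, p, t, u, q, m, r] = V" by (simp add: insert_commute)
    have out: "x \<in> V \<and> x \<notin> {v, w, t, u}" if "x \<in> {p, q, r, m}" for x using that X(1) m by blast
    have "m \<notin> {p, q, r}" using m by blast
    then have dist: "distinct [v, w, p, t, u, q, m, r]" using X(2) out ne False by auto
    have "R x v" if "x \<in> {p, t, u, q, m, r}" for x
      using w(3)[of x] that out[of x] t(1) assms(4) ne False by blast
    moreover have "R u x" if "x \<in> {v, w, p, q, m, r}" for x
      using t(3)[of x] that out[of x] w(1) assms(3) ne False by blast
    ultimately show ?thesis
      by (intro has_untangled_orderI[OF tour(1) dist V _ untangled8_disjoint])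
        (use X(3-5) w(2) t(2) in simp_all)
  qed
qed

lemma has_untangled_order_1556:
  assumes tour: "tournament_on V R" "card V = 8" and "v \<in> V" "u \<in> V" "a \<in> V" "b \<in> V" "a \<noteq> b"
    and d: "card {w \<in> V. R v w} = 1" "card {w \<in> V. R u w} = 6" "card {w \<in> V. R a w} = 5" "card {w \<in> V. R b w} = 5"
  shows "has_untangled_order V R"
proof -
  have ins: "card {w \<in> V. R w u} = 1" "card {w \<in> V. R w a} = 2" "card {w \<in> V. R w b} = 2"
    using card_in_out[OF tour(1) assms(4)] card_in_out[OF tour(1) assms(5)] card_in_out[OF tour(1) assms(6)] d tour(2) by simp_all
  have ne: "u \<noteq> v" "{a, b} \<inter> {u, v} = {}" using d by auto
  show ?thesis
  proof (cases "R v u")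
    case False
    then show ?thesis using has_untangled_order_out1_in1[OF tour assms(3,4) ne(1) d(1) ins(1)] by blast
  next
    case True
    obtain w where w: "w \<in> V" "R v w" "\<And>x. x \<in> V \<Longrightarrow> x \<noteq> v \<Longrightarrow> x \<noteq> w \<Longrightarrow> R x v"
      using unique_out_neighbourE[OF tour(1) assms(3) d(1)] by blast
    obtain t where t: "t \<in> V" "R t u" "\<And>x. x \<in> V \<Longrightarrow> x \<noteq> u \<Longrightarrow> x \<noteq> t \<Longrightarrow> R u x"
      using unique_in_neighbourE[OF tour(1) assms(4) ins(1)] by blast
    have "w = u" "t = v" using w(3)[OF assms(4) ne(1)] t(3)[OF assms(3)] ne(1) tournament_on_asym(1)[OF tour(1) assms(3,4) True] True by auto
    then show ?thesis
      using has_untangled_order_shared_arc[OF tour assms(3,4) True _ _ assms(5-7) ne(2) ins(2,3)] w(3) t(3) by blast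
  qed
qed

section \<open>Score sequences\<close>

lemma count_le_card_out_degree:
  assumes "finite (verts G)" "subseq xs (score_sequence G)"
  shows "length (filter ((=) k) xs) \<le> card {v \<in> verts G. out_degree G v = k}"
proof -
  have "length (filter ((=) k) xs) \<le> length (filter ((=) k) (score_sequence G))"
    using list_emb_length subseq_filter assms(2) by blast
  also have "\<dots> = count (mset (score_sequence G)) k"
    by (simp add: count_mset count_list_eq_length_filter)
  also have "\<dots> = card {v \<in> verts G. out_degree G v = k}"
    using assms(1) by (simp add: score_sequence_def count_image_mset' conj_commute eq_commute)
  finally show ?thesis .
qed

lemma out_degree_eq_card:
  assumes "digraph G" "v \<in> verts G"
  shows "out_degree G v = card {w \<in> verts G. (v, w) \<in> arcs_ends G}"
proof -
  interpret digraph G by fact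
  have "bij_betw (head G) (out_arcs G v) {w \<in> verts G. (v, w) \<in> arcs_ends G}"
    unfolding bij_betw_def
  proof
    show "inj_on (head G) (out_arcs G v)"
      using no_multi_arcs by (auto simp: inj_on_def out_arcs_def arc_to_ends_def)
    show "head G ` out_arcs G v = {w \<in> verts G. (v, w) \<in> arcs_ends G}"
      by (auto simp: arcs_ends_def arc_to_ends_def)
  qed
  then show ?thesis by (simp add: out_degree_def bij_betw_same_card)
qed

lemma ex2_if_card_ge_2: "2 \<le> card A \<Longrightarrow> \<exists>x\<in>A. \<exists>y\<in>A. x \<noteq> y"
  by (metis card_le_Suc0_iff_eq card.infinite not_less_eq_eq numeral_2_eq_2 zero_le)

theorem lemma3p4:
  fixes T :: "('a, 'b) pre_digraph" and S :: "nat list"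
  assumes "tournament T"
    and "card (verts T) = 8"
    and "S = score_sequence T"
    and "0 \<in> set S \<or> 7 \<in> set S \<or>
      subseq [1, 1] S \<or> subseq [6, 6] S \<or>
      subseq [1, 5, 5, 6] S \<or> subseq [1, 2, 2, 6] S"
  shows "\<not> intrinsically_linked_digraph T"
proof -
  define V where "V = verts T"
  define R where "R = (\<lambda>u v. (u, v) \<in> arcs_ends T)"
  define outs where "outs k = {v \<in> V. card {w \<in> V. R v w} = k}" for k
  have dig: "digraph T" using assms(1) by (simp add: tournament_def)
  have tour: "tournament_on V R" unfolding V_def R_def by (rule tournament_on_arcs_ends) fact
  then have fin: "finite V" by (simp add: tournament_on_def)
  have card8: "card V = 8" using assms(2) by (simp add: V_def)
  have outs: "length (filter ((=) k) xs) \<le> card (outs k)" if "subseq xs S" for k xs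
  proof -
    have "outs k = {v \<in> verts T. out_degree T v = k}"
      unfolding outs_def V_def R_def using out_degree_eq_card[OF dig] by auto
    then show ?thesis using count_le_card_out_degree[of T xs k] that fin assms(3) by (simp add: V_def)
  qed
  have one: "\<exists>v. v \<in> outs k" if "subseq xs S" "k \<in> set xs" for k xs
  proof -
    have "filter ((=) k) xs \<noteq> []" using that(2) by (auto simp: filter_empty_conv)
    then have "0 < card (outs k)"
      using outs[OF that(1), of k] by (metis length_greater_0_conv less_le_trans)
    then show ?thesis by (metis card_gt_0_iff ex_in_conv)
  qed
  have two: "\<exists>u v. u \<in> outs k \<and> v \<in> outs k \<and> u \<noteq> v" if "subseq xs S" "2 \<le> length (filter ((=) k) xs)" for k xs
  proof -
    have "2 \<le> card (outs k)" using outs[OF that(1), of k] that(2) by linarith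
    then show ?thesis using ex2_if_card_ge_2 by blast
  qed
  have tour': "tournament_on V R\<inverse>\<inverse>" using tour by (simp add: tournament_on_converse)
  have conv: "v \<in> V \<and> card {w \<in> V. R\<inverse>\<inverse> v w} = 7 - k" if "v \<in> outs k" for v k
  proof -
    have "v \<in> V" "card {w \<in> V. R v w} = k" using that by (auto simp: outs_def)
    then have "card {w \<in> V. R w v} = 7 - k" using card_in_out[OF tour, of v] card8 by simp
    then show ?thesis using \<open>v \<in> V\<close> by simp
  qed
  have "has_untangled_order V R"
    using assms(4)
  proof (elim disjE)
    assume "0 \<in> set S"
    then obtain v where "v \<in> outs 0" using one[of S] by auto
    then show ?thesis using has_untangled_order_sink[OF tour card8, of v] by (auto simp: outs_def)
  next
    assume "7 \<in> set S"
    then obtain v where "v \<in> outs 7" using one[of S] by auto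
    then have "has_untangled_order V R\<inverse>\<inverse>"
      using has_untangled_order_sink[OF tour' card8, of v] conv[of v 7] by simp
    then show ?thesis by (simp add: has_untangled_order_converse)
  next
    assume "subseq [1, 1] S"
    then obtain u v where "u \<in> outs 1" "v \<in> outs 1" "u \<noteq> v" using two[of "[1, 1]" 1] by auto
    then show ?thesis using has_untangled_order_two_out_degree_1[OF tour card8, of u v] by (simp add: outs_def)
  next
    assume "subseq [6, 6] S"
    then obtain u v where "u \<in> outs 6" "v \<in> outs 6" "u \<noteq> v" using two[of "[6, 6]" 6] by auto
    then have "has_untangled_order V R\<inverse>\<inverse>"
      using has_untangled_order_two_out_degree_1[OF tour' card8, of u v] conv[of u 6] conv[of v 6] by simp
    then show ?thesis by (simp add: has_untangled_order_converse)
  next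
    assume s: "subseq [1, 5, 5, 6] S"
    obtain v u where "v \<in> outs 1" "u \<in> outs 6" using one[OF s, of 1] one[OF s, of 6] by auto
    moreover obtain a b where "a \<in> outs 5" "b \<in> outs 5" "a \<noteq> b" using two[OF s, of 5] by auto
    ultimately show ?thesis using has_untangled_order_1556[OF tour card8, of v u a b] by (simp add: outs_def)
  next
    assume s: "subseq [1, 2, 2, 6] S"
    obtain u v where "u \<in> outs 1" "v \<in> outs 6" using one[OF s, of 1] one[OF s, of 6] by auto
    moreover obtain a b where "a \<in> outs 2" "b \<in> outs 2" "a \<noteq> b" using two[OF s, of 2] by auto
    ultimately have "has_untangled_order V R\<inverse>\<inverse>"
      using has_untangled_order_1556[OF tour' card8, of v u a b] conv[of u 1] conv[of v 6] conv[of a 2] conv[of b 2] by simp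
    then show ?thesis by (simp add: has_untangled_order_converse)
  qed
  then obtain vs where "distinct vs" "set vs = verts T" "untangled (length vs) (\<lambda>i j. (vs ! i, vs ! j) \<in> arcs_ends T)"
    unfolding has_untangled_order_def V_def R_def by (elim exE conjE)
  then show ?thesis by (rule not_intrinsically_linked_if_untangled[OF assms(1)])
qed

end
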